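(* Let $K$ be a field with a fixed algebraic closure $\overline{K}$, let $X$ be an indeterminate, and let $v$ be a valuation on $\overline{K}(X)$ such that the extension $(K(X)|K,v)$ is valuation transcendental. Let $(a,\gamma)$ be a minimal pair of definition for $v$ over $K$. Then $$(vK(a,X):vK(X))\,[K(a,X)v:K(X)v] = j,$$ where $j$ is the number of conjugates $a_i$ of $a$ over $K$ with $v(a-a_i)\geq\gamma$, including $a$ itself and counting multiplicities (that is, the number, with multiplicity, of roots $a_i\in\overline{K}$ of the minimal polynomial of $a$ over $K$ satisfying $v(a-a_i)\geq\gamma$).
   Context: Valuations are Krull valuations (of arbitrary rank), written additively, with $v0=\infty$. For a valued field $(F,v)$, $vF$ denotes the value group and $Fv$ the residue field; restrictions of $v$ to subfields are again denoted by $v$. The extension $(K(X)|K,v)$ is called valuation transcendental if $\dim_{\mathbb{Q}}\big(\mathbb{Q}\otimes_{\mathbb{Z}}(vK(X)/vK)\big)+\mathrm{trdeg}[K(X)v:Kv]=1$ (in general the left side is at most $1$). A pair $(a,\gamma)\in\overline{K}\times v\overline{K}(X)$ is a minimal pair of definition for $v$ over $K$ if (MP1) $v(X-a)=\gamma=\max\{v(X-c)\mid c\in\overline{K}\}$, and (MP2) for all $b\in\overline{K}$, $v(a-b)\geq\gamma$ implies $[K(b):K]\geq[K(a):K]$. *)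

theory Defs
  imports
    "HOL-Algebra.Algebra"
    "HOL-Algebra.Algebraic_Closure_Type"
    "HOL-Computational_Algebra.Computational_Algebra"
    "HOL-Library.Extended"
    "HOL-Library.Poly_Mapping"
begin

section \<open>Valuations\<close>

text \<open>
  Krull valuations, written additively, on a field given as a type.  The value \<open>v 0 = \<infinity>\<close> is
  \<^term>\<open>Pinf\<close>; the third element \<^term>\<open>Minf\<close> of \<^typ>\<open>'g extended\<close> is excluded.
  The map \<open>v\<close> need not be onto: value groups are subgroups of \<^typ>\<open>'g\<close>.
\<close>

definition valuation :: "('f::field \<Rightarrow> 'g::linordered_ab_group_add extended) \<Rightarrow> bool" where
  "valuation v \<longleftrightarrow>
     (\<forall>x. v x \<noteq> Minf) \<and>
     (\<forall>x. v x = Pinf \<longleftrightarrow> x = 0) \<and>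
     (\<forall>x y. v (x * y) = v x + v y) \<and>
     (\<forall>x y. min (v x) (v y) \<le> v (x + y))"

text \<open>
  The value group \<open>vF\<close> of a subfield \<open>F\<close>, as a group in the sense of HOL-Algebra.
  The condition \<open>v x = Fin g\<close> already forces \<open>x \<noteq> 0\<close>.
\<close>

definition value_group ::
  "('f::field \<Rightarrow> 'g::linordered_ab_group_add extended) \<Rightarrow> 'f set \<Rightarrow> 'g monoid" where
  "value_group v F = \<lparr>carrier = {g. \<exists>x\<in>F. v x = Fin g}, monoid.mult = (+), one = 0\<rparr>"

definition residue_field ::
  "('f::field \<Rightarrow> 'g::linordered_ab_group_add extended) \<Rightarrow> 'f set ring" where
  "residue_field v =
     (ring_of_type_algebra\<lparr>carrier := {x. 0 \<le> v x}\<rparr>) Quot {x. 0 < v x}"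

text \<open>
  The residue field \<open>Fv\<close> of a subfield \<open>F\<close>, viewed in the usual way as a subfield of the residue
  field of the whole field: it consists of the residues of the elements of the valuation ring of
  \<open>F\<close>, and the kernel of the residue map on that ring is the maximal ideal of the restriction of
  \<open>v\<close> to \<open>F\<close>.
\<close>

definition residue_subfield ::
  "('f::field \<Rightarrow> 'g::linordered_ab_group_add extended) \<Rightarrow> 'f set \<Rightarrow> 'f set set" where
  "residue_subfield v F =
     (\<lambda>x. {y. 0 < v y} +>\<^bsub>ring_of_type_algebra\<lparr>carrier := {x. 0 \<le> v x}\<rparr>\<^esub> x) ` {x \<in> F. 0 \<le> v x}"


section \<open>Indices and degrees\<close>

text \<open>Both are \<open>0\<close> when the index, respectively the degree, is infinite.\<close>

definition group_index :: "('c, 'm) monoid_scheme \<Rightarrow> 'c set \<Rightarrow> nat" where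
  "group_index G H = card (rcosets\<^bsub>G\<^esub> H)"

definition ext_degree :: "('c, 'm) ring_scheme \<Rightarrow> 'c set \<Rightarrow> 'c set \<Rightarrow> nat" where
  "ext_degree R F E = (if ring.finite_dimension R F E then ring.dim R F E else 0)"


section \<open>Transcendence degree\<close>

text \<open>
  A finite set \<open>S\<close> is algebraically independent over \<open>F\<close> if no nonzero polynomial over \<open>F\<close> in
  variables indexed by \<open>S\<close> vanishes at \<open>S\<close>.  The polynomial is given by a finite set \<open>M\<close> of
  exponent vectors with coefficients \<open>c\<close>.
\<close>

definition alg_independent :: "('c, 'm) ring_scheme \<Rightarrow> 'c set \<Rightarrow> 'c set \<Rightarrow> bool" where
  "alg_independent R F S \<longleftrightarrow>
     (\<forall>M (c :: ('c \<Rightarrow> nat) \<Rightarrow> 'c).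
        finite M \<and> M \<subseteq> (S \<rightarrow>\<^sub>E UNIV) \<and> c \<in> M \<rightarrow> F \<and>
        (\<Oplus>\<^bsub>R\<^esub>m\<in>M. c m \<otimes>\<^bsub>R\<^esub> (\<Otimes>\<^bsub>R\<^esub>s\<in>S. s [^]\<^bsub>R\<^esub> m s)) = \<zero>\<^bsub>R\<^esub>
        \<longrightarrow> (\<forall>m\<in>M. c m = \<zero>\<^bsub>R\<^esub>))"

definition has_trdeg :: "('c, 'm) ring_scheme \<Rightarrow> 'c set \<Rightarrow> 'c set \<Rightarrow> nat \<Rightarrow> bool" where
  "has_trdeg R F E n \<longleftrightarrow>
     (\<exists>S. finite S \<and> card S = n \<and> S \<subseteq> E \<and> alg_independent R F S \<and>
          (\<forall>x\<in>E. \<not> ring.transcendental R (generate_field R (F \<union> S)) x))"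


section \<open>The rational vector space generated by an abelian group\<close>

text \<open>The tensor product over the integers of two abelian groups (written multiplicatively).\<close>

definition tensor_relations ::
  "('c, 'm) monoid_scheme \<Rightarrow> ('d, 'n) monoid_scheme \<Rightarrow> ('c \<times> 'd \<Rightarrow>\<^sub>0 int) set" where
  "tensor_relations A B =
     generate (free_Abelian_group (carrier A \<times> carrier B))
       ({frag_of (x \<otimes>\<^bsub>A\<^esub> x', y) - frag_of (x, y) - frag_of (x', y) | x x' y.
            x \<in> carrier A \<and> x' \<in> carrier A \<and> y \<in> carrier B} \<union>
        {frag_of (x, y \<otimes>\<^bsub>B\<^esub> y') - frag_of (x, y) - frag_of (x, y') | x y y'.
            x \<in> carrier A \<and> y \<in> carrier B \<and> y' \<in> carrier B})"

definition tensor_product ::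
  "('c, 'm) monoid_scheme \<Rightarrow> ('d, 'n) monoid_scheme \<Rightarrow> ('c \<times> 'd \<Rightarrow>\<^sub>0 int) set monoid" where
  "tensor_product A B =
     free_Abelian_group (carrier A \<times> carrier B) Mod tensor_relations A B"

text \<open>
  \<open>\<rat> \<otimes> A\<close> as a vector space over the rationals, with \<open>q \<cdot> (r \<otimes> x) = (q r) \<otimes> x\<close>.  The
  ring multiplication in the \<^typ>\<open>('c, 'd) module\<close> record plays no role.
\<close>

definition rat_tensor ::
  "('c, 'm) monoid_scheme \<Rightarrow> (rat, (rat \<times> 'c \<Rightarrow>\<^sub>0 int) set) module" where
  "rat_tensor A =
     (let Q = add_monoid (ring_of_type_algebra :: rat ring); T = tensor_product Q A in
      \<lparr>carrier = carrier T, monoid.mult = undefined, one = undefined,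
       ring.zero = one T, add = monoid.mult T,
       module.smult = (\<lambda>q U. \<Union>u\<in>U. tensor_relations Q A
                  #>\<^bsub>free_Abelian_group (carrier Q \<times> carrier A)\<^esub>
                  frag_extend (\<lambda>(r, x). frag_of (q * r, x)) u)\<rparr>)"

text \<open>\<open>M\<close> has a basis with \<open>n\<close> elements over the field \<open>k\<close>.\<close>

definition has_vdim :: "('k, 'm) ring_scheme \<Rightarrow> ('k, 'c, 'n) module_scheme \<Rightarrow> nat \<Rightarrow> bool" where
  "has_vdim k M n \<longleftrightarrow>
     (\<exists>B. finite B \<and> card B = n \<and> B \<subseteq> carrier M \<and>
          (\<forall>x\<in>carrier M. \<exists>!c. c \<in> B \<rightarrow>\<^sub>E carrier k \<and> x = (\<Oplus>\<^bsub>M\<^esub>b\<in>B. c b \<odot>\<^bsub>M\<^esub> b)))"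


section \<open>Extensions to the rational function field\<close>

text \<open>
  Throughout, the type \<^typ>\<open>'a\<close> is the algebraic closure of its subfield \<open>K\<close>, and
  \<^typ>\<open>'a poly fract\<close> is the rational function field over this closure.
\<close>

abbreviation const :: "'a::field \<Rightarrow> 'a poly fract" where
  "const c \<equiv> to_fract [:c:]"

abbreviation indet :: "'a::field poly fract" where
  "indet \<equiv> to_fract [:0, 1:]"

definition ratfun :: "'a::field set \<Rightarrow> 'a poly fract set" where
  "ratfun H = generate_field ring_of_type_algebra (insert indet (const ` H))"

text \<open>The sum of the two dimensions is \<open>1\<close>; in particular both are finite.\<close>

definition valuation_transcendental ::
  "('a::field poly fract \<Rightarrow> 'g::linordered_ab_group_add extended) \<Rightarrow> 'a set \<Rightarrow> bool" where
  "valuation_transcendental v K \<longleftrightarrow>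
     (\<exists>r t. has_vdim (ring_of_type_algebra :: rat ring)
               (rat_tensor (value_group v (ratfun K) Mod carrier (value_group v (const ` K)))) r \<and>
            has_trdeg (residue_field v) (residue_subfield v (const ` K))
               (residue_subfield v (ratfun K)) t \<and>
            r + t = 1)"

definition degree_over :: "'a::field set \<Rightarrow> 'a \<Rightarrow> nat" where
  "degree_over K b =
     ext_degree ring_of_type_algebra K (generate_field ring_of_type_algebra (insert b K))"

definition minimal_pair ::
  "('a::field poly fract \<Rightarrow> 'g::linordered_ab_group_add extended) \<Rightarrow> 'a set \<Rightarrow> 'a \<Rightarrow> 'g \<Rightarrow> bool"
  where
  "minimal_pair v K a \<gamma> \<longleftrightarrow>
     v (indet - const a) = Fin \<gamma> \<and>
     (\<forall>c. v (indet - const c) \<le> Fin \<gamma>) \<and>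
     (\<forall>b. v (const (a - b)) \<ge> Fin \<gamma> \<longrightarrow> degree_over K b \<ge> degree_over K a)"

text \<open>
  The roots, with multiplicity, of the minimal polynomial of \<open>a\<close> over \<open>K\<close> that lie in the ball of
  radius \<open>\<gamma>\<close> around \<open>a\<close>.
\<close>

definition near_conjugates ::
  "('a::field poly fract \<Rightarrow> 'g::linordered_ab_group_add extended) \<Rightarrow> 'a set \<Rightarrow> 'a \<Rightarrow> 'g
     \<Rightarrow> 'a multiset" where
  "near_conjugates v K a \<gamma> =
     {# b \<in># ring.roots ring_of_type_algebra (ring.Irr ring_of_type_algebra K a).
        v (const (a - b)) \<ge> Fin \<gamma> #}"

end

theory Submission
  imports Defs
begin

text \<open>
  Write \<open>T = X - a\<close> and let \<open>f\<close> be the minimal polynomial of \<open>a\<close> over \<open>K\<close>.  Call \<open>b\<close> near if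
  \<open>v (a - b) \<ge> \<gamma>\<close>.  Since \<open>v T = \<gamma>\<close> is maximal among the values of the \<open>X - b\<close>, such a
  linear factor has value \<open>\<gamma>\<close> if \<open>b\<close> is near and \<open>v (a - b) < \<gamma>\<close> otherwise.  As every polynomial
  over the algebraic closure is a product of linear factors, its value is the minimum of the values of its Taylor
  terms \<open>c * T ^ m\<close> at \<open>a\<close>, and the number of its near roots, here called its initial degree, is the
  largest \<open>m\<close> at which the minimum is attained (\<open>taylor_term_bounds\<close>).  The initial
  degree is therefore the degree in \<open>T\<close> of the leading part of the polynomial.  It is additive on products,
  and polynomials of different initial degrees cannot cancel in a sum (\<open>initial_degree_add\<close>).

  By the second condition on a minimal pair, a nonzero polynomial \<open>q\<close> over \<open>K\<close> of degree less than
  \<open>[K(a):K]\<close> has no near root.  Hence its initial degree is \<open>0\<close>, and \<open>q(X)\<close> differs from \<open>q(a)\<close>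
  only by an element of larger value (\<open>close_to_value\<close>).  This has two consequences, where \<open>j\<close> is the
  initial degree of \<open>f\<close>, the number of near conjugates of \<open>a\<close>.

  \<^item> By expansion in powers of \<open>f\<close>, the initial degrees of polynomials over \<open>K\<close> are multiples of \<open>j\<close>.
    So in a sum of terms \<open>c i * T ^ i\<close> with \<open>i < j\<close> and \<open>c i\<close> in \<open>K(X)\<close>, the initial degrees are
    distinct modulo \<open>j\<close> and no cancellation occurs (\<open>powers_independent\<close>).

  \<^item> Up to larger value, the elements of \<open>K(a)\<close> lie in \<open>K[X]\<close>.  Division of leading parts by powers of the
    leading part of \<open>f\<close>, whose degree is \<open>j\<close>, shows that every polynomial over \<open>K(a)\<close>
    agrees up to larger value with such a sum (\<open>approximate_polys\<close>).  The same follows for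
    \<open>K(a,X)\<close>, since denominators can be taken over \<open>K\<close> (\<open>ratfun_insert\<close>).

  In other words, \<open>T ^ i\<close> for \<open>i < j\<close> is a basis of the graded algebra of \<open>K(a,X)\<close> over that of \<open>K(X)\<close>.
  For any extension with such a basis, sort the basis elements by their values modulo the smaller
  value group.  Those in one coset, normalised to a common value, give a basis of the extension of residue fields.
  So every coset contains the same number of basis elements, the residue degree, and the number of
  basis elements is the index times the residue degree (\<open>valuation_basis.index_times_degree\<close>).
\<close>

section \<open>Subfields of a field given as a type\<close>

lemma type_ring_simps [simp]:
  "carrier ring_of_type_algebra = UNIV"
  "x \<otimes>\<^bsub>ring_of_type_algebra\<^esub> y = x * y"
  "x \<oplus>\<^bsub>ring_of_type_algebra\<^esub> y = x + y"
  "\<one>\<^bsub>ring_of_type_algebra\<^esub> = 1"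
  "\<zero>\<^bsub>ring_of_type_algebra\<^esub> = 0"
  by (simp_all add: ring_of_type_algebra_def)

lemma type_ring_a_inv [simp]:
  "\<ominus>\<^bsub>ring_of_type_algebra\<^esub> (x::'f::field) = - x"
proof -
  interpret R: field "ring_of_type_algebra :: 'f ring" by (rule field_from_type_algebra)
  show ?thesis using R.minus_equality[of "- x" x] by simp
qed

lemma type_ring_m_inv [simp]:
  assumes "(x::'f::field) \<noteq> 0"
  shows "inv\<^bsub>ring_of_type_algebra\<^esub> x = inverse x"
proof -
  interpret R: field "ring_of_type_algebra :: 'f ring" by (rule field_from_type_algebra)
  show ?thesis using R.comm_inv_char[of x "inverse x"] assms by simp
qed

abbreviation is_subfield :: "'f::field set \<Rightarrow> bool" where
  "is_subfield F \<equiv> subfield F ring_of_type_algebra"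

lemma is_subfieldD:
  fixes F :: "'f::field set"
  assumes "is_subfield F"
  shows "0 \<in> F" "1 \<in> F" "x \<in> F \<Longrightarrow> y \<in> F \<Longrightarrow> x + y \<in> F" "x \<in> F \<Longrightarrow> y \<in> F \<Longrightarrow> x * y \<in> F"
    "x \<in> F \<Longrightarrow> - x \<in> F" "x \<in> F \<Longrightarrow> y \<in> F \<Longrightarrow> x - y \<in> F" "x \<in> F \<Longrightarrow> inverse x \<in> F"
    "x \<in> F \<Longrightarrow> y \<in> F \<Longrightarrow> x / y \<in> F"
proof -
  interpret R: field "ring_of_type_algebra :: 'f ring" by (rule field_from_type_algebra)
  note F = subringE[OF subfieldE(1)[OF assms]]
  show "0 \<in> F" "1 \<in> F" and add: "x \<in> F \<Longrightarrow> y \<in> F \<Longrightarrow> x + y \<in> F" for x y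
    using F(2,3) F(7)[of x y] by simp_all
  show mult: "x \<in> F \<Longrightarrow> y \<in> F \<Longrightarrow> x * y \<in> F" and um: "x \<in> F \<Longrightarrow> - x \<in> F" for x y
    using F(6)[of x y] F(5)[of x] by simp_all
  show "x \<in> F \<Longrightarrow> y \<in> F \<Longrightarrow> x - y \<in> F" for x y
    using add[of x "- y"] um[of y] by simp
  show inv: "inverse x \<in> F" if "x \<in> F" for x
    using R.subfield_m_inv(1)[OF assms, of x] that by (cases "x = 0") auto
  show "x \<in> F \<Longrightarrow> y \<in> F \<Longrightarrow> x / y \<in> F" for x y
    using mult[of x "inverse y"] inv[of y] by (simp add: field_simps)
qed

lemma is_subfieldI:
  fixes F :: "'f::field set"
  assumes "1 \<in> F" "\<And>x y. x \<in> F \<Longrightarrow> y \<in> F \<Longrightarrow> x + y \<in> F" "\<And>x y. x \<in> F \<Longrightarrow> y \<in> F \<Longrightarrow> x * y \<in> F"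
    "\<And>x. x \<in> F \<Longrightarrow> - x \<in> F" "\<And>x. x \<in> F \<Longrightarrow> x \<noteq> 0 \<Longrightarrow> inverse x \<in> F"
  shows "is_subfield F"
proof -
  interpret R: field "ring_of_type_algebra :: 'f ring" by (rule field_from_type_algebra)
  show ?thesis
    by (rule R.subfieldI'[OF R.subringI]) (use assms in auto)
qed

lemma is_subfield_sum:
  assumes "is_subfield F" "\<And>i. i \<in> I \<Longrightarrow> c i \<in> F"
  shows "sum c I \<in> F"
  using assms(2) by (induction I rule: infinite_finite_induct) (auto intro: is_subfieldD[OF assms(1)])

lemma is_subfield_power:
  assumes "is_subfield F" "x \<in> F"
  shows "x ^ n \<in> F"
  by (induction n) (auto intro: is_subfieldD[OF assms(1)] assms(2))

section \<open>Valuations\<close>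

lemma extended_add_strict_mono:
  fixes a b c d :: "'g::linordered_ab_group_add extended"
  assumes "a \<le> b" "c < d" "a \<noteq> Pinf" "a \<noteq> Minf" "c \<noteq> Minf" 
  shows "a + c < b + d"
  using assms by (cases a; cases b; cases c; cases d) (auto intro: add_le_less_mono)

locale valued_field =
  fixes v :: "'f::field \<Rightarrow> 'g::linordered_ab_group_add extended"
  assumes valuation: "valuation v"
begin

lemma v_not_Minf [simp]: "v x \<noteq> Minf"
  and v_eq_Pinf [simp]: "v x = Pinf \<longleftrightarrow> x = 0"
  and v_mult: "v (x * y) = v x + v y"
  and v_add: "min (v x) (v y) \<le> v (x + y)"
  using valuation unfolding valuation_def by blast+

lemma v_0 [simp]: "v 0 = Pinf"
  by simp

lemma v_finite: obtains g where "v x = Fin g" | "x = 0"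
  by (cases "v x") auto

lemma v_less_Pinf [simp]: "v x < Pinf \<longleftrightarrow> x \<noteq> 0"
  by (cases "v x") auto

lemma v_less_nonzero: "v x < g \<Longrightarrow> x \<noteq> 0"
  by (auto simp: less_le)

lemma v_1 [simp]: "v 1 = 0"
  using v_mult[of 1 1] by (cases "v 1") (auto simp: zero_extended_def)

lemma v_minus [simp]: "v (- x) = v x"
proof -
  have "v (- 1) + v (- 1) = 0"
    using v_mult[of "- 1" "- 1"] by simp
  hence "v (- 1) = 0"
    by (cases "v (- 1)") (auto simp: zero_extended_def)
  thus ?thesis
    using v_mult[of "- 1" x] by simp
qed

lemma v_minus_commute: "v (x - y) = v (y - x)"
  using v_minus[of "x - y"] by simp

lemma v_add_ge: "g \<le> v x \<Longrightarrow> g \<le> v y \<Longrightarrow> g \<le> v (x + y)"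
  using v_add[of x y] by (auto simp: min_def split: if_splits)

lemma v_add_gt: "g < v x \<Longrightarrow> g < v y \<Longrightarrow> g < v (x + y)"
  using v_add[of x y] by (auto simp: min_def split: if_splits)

lemma v_diff_ge: "g \<le> v x \<Longrightarrow> g \<le> v y \<Longrightarrow> g \<le> v (x - y)"
  using v_add_ge[of g x "- y"] by simp

lemma v_diff_gt: "g < v x \<Longrightarrow> g < v y \<Longrightarrow> g < v (x - y)"
  using v_add_gt[of g x "- y"] by simp

lemma v_sum_ge: "(\<And>i. i \<in> I \<Longrightarrow> g \<le> v (f i)) \<Longrightarrow> g \<le> v (sum f I)"
  by (induction I rule: infinite_finite_induct) (auto intro: v_add_ge)

lemma v_sum_gt: "g < Pinf \<Longrightarrow> (\<And>i. i \<in> I \<Longrightarrow> g < v (f i)) \<Longrightarrow> g < v (sum f I)"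
  by (induction I rule: infinite_finite_induct) (auto intro: v_add_gt)

lemma v_add_eq: "v x < v y \<Longrightarrow> v (x + y) = v x"
proof (rule antisym)
  assume a: "v x < v y"
  show "v x \<le> v (x + y)" using a by (intro v_add_ge) auto
  show "v (x + y) \<le> v x"
  proof (rule ccontr)
    assume "\<not> ?thesis"
    hence "v x < v ((x + y) - y)" using a by (intro v_diff_gt) auto
    thus False by simp
  qed
qed

lemma v_close_eq: "v x < v (x - y) \<Longrightarrow> v y = v x"
  using v_add_eq[of x "y - x"] by (simp add: v_minus_commute[of x y])

lemma v_mult_mono: "v x \<le> v x' \<Longrightarrow> v y \<le> v y' \<Longrightarrow> v (x * y) \<le> v (x' * y')"
  by (simp add: v_mult add_mono)

lemma v_mult_strict_mono: "x \<noteq> 0 \<Longrightarrow> v x \<le> v x' \<Longrightarrow> v y < v y' \<Longrightarrow> v (x * y) < v (x' * y')"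
  by (simp add: v_mult extended_add_strict_mono)

lemma v_mult_less_cancel: "x \<noteq> 0 \<Longrightarrow> v (x * y) < v (x * z) \<longleftrightarrow> v y < v z"
  using v_mult_strict_mono[of x x y z] v_mult_mono[of x x z y] by (auto simp: not_le[symmetric])

lemma v_mult_le_cancel: "x \<noteq> 0 \<Longrightarrow> v (x * y) \<le> v (x * z) \<longleftrightarrow> v y \<le> v z"
  using v_mult_less_cancel[of x z y] by (auto simp: not_less[symmetric])

lemma v_divide_self: "v x = v z \<Longrightarrow> z \<noteq> 0 \<Longrightarrow> v (x / z) = 0"
  using v_mult[of "x / z" z] by (cases "v z"; cases "v (x / z)") (auto simp: zero_extended_def)

lemma v_divide_Fin: "v x = Fin g \<Longrightarrow> v y = Fin h \<Longrightarrow> v (x / y) = Fin (g - h)"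
proof -
  assume a: "v x = Fin g" "v y = Fin h"
  hence "y \<noteq> 0" by auto
  thus ?thesis using a v_mult[of "x / y" y] by (cases "v (x / y)") auto
qed

end

section \<open>Residue fields\<close>

context valued_field
begin

definition valuation_ring :: "'f ring" where
  "valuation_ring = ring_of_type_algebra\<lparr>carrier := {x. 0 \<le> v x}\<rparr>"

definition residue :: "'f \<Rightarrow> 'f set" where
  "residue x = {y. 0 < v y} +>\<^bsub>valuation_ring\<^esub> x"

lemma valuation_ring_simps [simp]:
  "carrier valuation_ring = {x. 0 \<le> v x}"
  "x \<otimes>\<^bsub>valuation_ring\<^esub> y = x * y"
  "x \<oplus>\<^bsub>valuation_ring\<^esub> y = x + y"
  "\<one>\<^bsub>valuation_ring\<^esub> = 1"
  "\<zero>\<^bsub>valuation_ring\<^esub> = 0"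
  by (simp_all add: valuation_ring_def ring_of_type_algebra_def)

lemma v_mult_nonneg: "0 \<le> v x \<Longrightarrow> 0 \<le> v y \<Longrightarrow> 0 \<le> v (x * y)"
  using v_mult_mono[of 1 x 1 y] by simp

lemma v_mult_pos: "0 \<le> v x \<Longrightarrow> 0 < v y \<Longrightarrow> 0 < v (x * y)"
  using v_mult_strict_mono[of 1 x 1 y] by simp

lemma v_mult_pos': "0 < v x \<Longrightarrow> 0 \<le> v y \<Longrightarrow> 0 < v (x * y)"
  using v_mult_pos[of y x] by (simp add: mult.commute)

lemma cring_valuation_ring: "cring valuation_ring"
proof -
  interpret R: field "ring_of_type_algebra :: 'f ring" by (rule field_from_type_algebra)
  have "subring {x. 0 \<le> v x} (ring_of_type_algebra :: 'f ring)"
    by (rule R.subringI) (auto intro: v_mult_nonneg v_add_ge)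
  hence "cring (ring_of_type_algebra\<lparr>carrier := {x. 0 \<le> v x}\<rparr>)"
    using R.subcring_iff[of "{x. 0 \<le> v x}"] R.subcringI' by simp
  thus ?thesis
    by (simp add: valuation_ring_def)
qed

lemma ideal_maximal: "ideal {x. 0 < v x} valuation_ring"
proof -
  interpret O: cring valuation_ring by (rule cring_valuation_ring)
  have inv: "\<ominus>\<^bsub>valuation_ring\<^esub> x = - x" if "0 \<le> v x" for x
    using O.minus_equality[of "- x" x] that by simp
  show ?thesis
  proof (rule idealI[OF O.ring_axioms])
    show "subgroup {x. 0 < v x} (add_monoid valuation_ring)"
    proof (rule O.add.subgroupI)
      have "0 < v 0"
        by (simp add: zero_extended_def)
      thus "{x. 0 < v x} \<noteq> {}" by blast
    qed (auto intro: v_add_gt simp: inv less_imp_le)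
  qed (auto intro: v_mult_pos v_mult_pos')
qed

lemma residue_field_eq: "residue_field v = valuation_ring Quot {x. 0 < v x}"
  by (simp add: residue_field_def valuation_ring_def)

lemma residue_subfield_eq: "residue_subfield v F = residue ` {x \<in> F. 0 \<le> v x}"
  by (simp add: residue_subfield_def residue_def valuation_ring_def)

lemma residue_hom: "ring_hom_cring valuation_ring (residue_field v) residue"
proof -
  interpret I: ideal "{x. 0 < v x}" valuation_ring by (rule ideal_maximal)
  show ?thesis
    using I.rcos_ring_hom_cring[OF cring_valuation_ring]
    unfolding residue_field_eq residue_def .
qed

lemma cring_residue_field: "cring (residue_field v)"
  using residue_hom by (simp add: ring_hom_cring_def)

lemma residue_eq_iff:
  assumes "0 \<le> v x" "0 \<le> v y"
  shows "residue x = residue y \<longleftrightarrow> 0 < v (x - y)"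
proof -
  interpret O: cring valuation_ring by (rule cring_valuation_ring)
  interpret I: ideal "{x. 0 < v x}" valuation_ring by (rule ideal_maximal)
  have "x \<ominus>\<^bsub>valuation_ring\<^esub> y = x - y"
    using O.minus_equality[of "- y" y] assms by (simp add: O.minus_eq)
  thus ?thesis
    using O.quotient_eq_iff_same_a_r_cos[OF ideal_maximal, of x y] assms by (simp add: residue_def)
qed

lemma residue_ops:
  assumes "0 \<le> v x" "0 \<le> v y"
  shows "residue x \<oplus>\<^bsub>residue_field v\<^esub> residue y = residue (x + y)"
    "residue x \<otimes>\<^bsub>residue_field v\<^esub> residue y = residue (x * y)"
    "residue x \<in> carrier (residue_field v)"
proof -
  interpret h: ring_hom_cring valuation_ring "residue_field v" residue by (rule residue_hom)
  show "residue x \<oplus>\<^bsub>residue_field v\<^esub> residue y = residue (x + y)"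
    "residue x \<otimes>\<^bsub>residue_field v\<^esub> residue y = residue (x * y)"
    "residue x \<in> carrier (residue_field v)"
    using assms h.hom_add[of x y] h.hom_mult[of x y] h.hom_closed[of x] by simp_all
qed

lemma residue_0: "\<zero>\<^bsub>residue_field v\<^esub> = residue 0" and residue_1: "\<one>\<^bsub>residue_field v\<^esub> = residue 1"
proof -
  interpret h: ring_hom_cring valuation_ring "residue_field v" residue by (rule residue_hom)
  show "\<zero>\<^bsub>residue_field v\<^esub> = residue 0" "\<one>\<^bsub>residue_field v\<^esub> = residue 1"
    using h.hom_zero h.hom_one by simp_all
qed

lemma residue_eq_0_iff: "0 \<le> v x \<Longrightarrow> residue x = \<zero>\<^bsub>residue_field v\<^esub> \<longleftrightarrow> 0 < v x"
  by (simp add: residue_0 residue_eq_iff)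

lemma subfield_residue_subfield:
  assumes F: "is_subfield F"
  shows "subfield (residue_subfield v F) (residue_field v)"
proof -
  interpret k: cring "residue_field v" by (rule cring_residue_field)
  interpret h: ring_hom_cring valuation_ring "residue_field v" residue by (rule residue_hom)
  let ?F = "residue_subfield v F"
  note closed = is_subfieldD[OF F]
  have "subring {x \<in> F. 0 \<le> v x} valuation_ring"
  proof -
    have "\<ominus>\<^bsub>valuation_ring\<^esub> x = - x" if "0 \<le> v x" for x
      using h.R.minus_equality[of "- x" x] that by simp
    thus ?thesis
      by (intro h.R.subringI) (auto intro: closed v_mult_nonneg v_add_ge)
  qed
  hence sub: "subring ?F (residue_field v)"
    unfolding residue_subfield_eq
    by (rule ring_hom_ring.img_is_subring[OF ring_hom_ringI2[OF h.R.ring_axioms k.ring_axioms h.homh]])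
  have inv: "\<exists>y\<in>?F. x \<otimes>\<^bsub>residue_field v\<^esub> y = \<one>\<^bsub>residue_field v\<^esub>"
    if "x \<in> ?F" "x \<noteq> \<zero>\<^bsub>residue_field v\<^esub>" for x
  proof -
    obtain z where z: "z \<in> F" "0 \<le> v z" "x = residue z"
      using \<open>x \<in> ?F\<close> by (auto simp: residue_subfield_eq)
    hence "v z = 0" using that(2) residue_eq_0_iff[of z] by auto
    hence z0: "z \<noteq> 0" by (auto simp: zero_extended_def)
    have "v (inverse z) = 0"
      using v_divide_self[of 1 z] \<open>v z = 0\<close> z0 by (simp add: inverse_eq_divide)
    hence "residue (inverse z) \<in> ?F" "residue z \<otimes>\<^bsub>residue_field v\<^esub> residue (inverse z) = residue 1"
      using z z0 closed(7)[of z] by (auto simp: residue_subfield_eq residue_ops)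
    thus ?thesis using z(3) residue_1 by auto
  qed
  have one_neq_zero: "\<one>\<^bsub>residue_field v\<^esub> \<noteq> \<zero>\<^bsub>residue_field v\<^esub>"
    using residue_eq_0_iff[of 1] residue_1 by simp
  show ?thesis
  proof (rule k.subfieldI[OF k.subcringI'[OF sub]])
    show "Units (residue_field v\<lparr>carrier := ?F\<rparr>) = ?F - {\<zero>\<^bsub>residue_field v\<^esub>}"
    proof (intro equalityI subsetI)
      fix x assume "x \<in> Units (residue_field v\<lparr>carrier := ?F\<rparr>)"
      then obtain y where "x \<in> ?F" "y \<in> ?F" "x \<otimes>\<^bsub>residue_field v\<^esub> y = \<one>\<^bsub>residue_field v\<^esub>"
        by (auto simp: Units_def)
      thus "x \<in> ?F - {\<zero>\<^bsub>residue_field v\<^esub>}"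
        using one_neq_zero k.l_null[of y] subringE(1)[OF sub] by auto
    next
      fix x assume x: "x \<in> ?F - {\<zero>\<^bsub>residue_field v\<^esub>}"
      then obtain y where y: "y \<in> ?F" "x \<otimes>\<^bsub>residue_field v\<^esub> y = \<one>\<^bsub>residue_field v\<^esub>"
        using inv[of x] by blast
      moreover have "y \<otimes>\<^bsub>residue_field v\<^esub> x = \<one>\<^bsub>residue_field v\<^esub>"
        using x y k.m_comm[of y x] subringE(1)[OF sub] by auto
      ultimately show "x \<in> Units (residue_field v\<lparr>carrier := ?F\<rparr>)"
        using x unfolding Units_def by auto
    qed
  qed
qed

text \<open>
  The bridge between linear combinations in the residue field, which are written with lists, and
  sums over a finite index set in the valuation ring.
\<close>

lemma combine_residue:
  assumes "\<And>i. i \<in> set is \<Longrightarrow> 0 \<le> v (c i) \<and> 0 \<le> v (u i)" "distinct is"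
  shows "ring.combine (residue_field v) (map (residue \<circ> c) is) (map (residue \<circ> u) is)
           = residue (\<Sum>i\<in>set is. c i * u i)"
proof -
  interpret k: cring "residue_field v" by (rule cring_residue_field)
  show ?thesis
    using assms
  proof (induction "is")
    case (Cons i "is")
    have "0 \<le> v (\<Sum>i\<in>set is. c i * u i)"
      using Cons.prems by (intro v_sum_ge) (auto intro: v_mult_nonneg)
    thus ?case
      using Cons v_mult_nonneg[of "c i" "u i"] by (simp add: residue_ops)
  qed (simp add: residue_0)
qed

lemma residue_subfield_lists:
  assumes "set ks \<subseteq> residue_subfield v F" "length ks = length is" "distinct is"
  obtains c where "\<And>i. i \<in> set is \<Longrightarrow> c i \<in> F \<and> 0 \<le> v (c i)" "ks = map (residue \<circ> c) is"
proof -
  have "\<exists>c. (\<forall>i\<in>set is. c i \<in> F \<and> 0 \<le> v (c i)) \<and> ks = map (residue \<circ> c) is"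
    using assms(2,1,3)
  proof (induction rule: list_induct2)
    case (Cons k ks i "is")
    then obtain c where c: "\<forall>i\<in>set is. c i \<in> F \<and> 0 \<le> v (c i)" "ks = map (residue \<circ> c) is"
      by auto
    obtain x where "x \<in> F" "0 \<le> v x" "k = residue x"
      using Cons.prems by (auto simp: residue_subfield_eq)
    moreover have "map (residue \<circ> c(i := x)) is = map (residue \<circ> c) is"
      using Cons.prems(2) by (intro map_cong) auto
    ultimately have "\<forall>j\<in>set (i # is). (c(i := x)) j \<in> F \<and> 0 \<le> v ((c(i := x)) j)"
        "k # ks = map (residue \<circ> c(i := x)) (i # is)"
      using c by simp_all
    thus ?case by (intro exI[of _ "c(i := x)"] conjI)
  qed simp
  thus ?thesis using that by blast
qed

end

section \<open>Valuation bases\<close>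

text \<open>
  The elements \<open>t i\<close> are a basis of the graded algebra of \<open>E\<close> over the graded algebra of \<open>F\<close>.
  The assumption \<open>independent\<close> says that leading parts of the terms \<open>c i * t i\<close> cannot cancel, and
  \<open>approximation\<close> that they span: every element agrees with a combination up to an
  error of larger value.  The elements need not span \<open>E\<close> over \<open>F\<close> as a vector space, so the
  degree of \<open>E\<close> over \<open>F\<close> may be larger than the number of the \<open>t i\<close>.
\<close>

locale valuation_basis = valued_field v
  for v :: "'f::field \<Rightarrow> 'g::linordered_ab_group_add extended" +
  fixes F E :: "'f set" and I :: "'i set" and t :: "'i \<Rightarrow> 'f"
  assumes subfield_F: "is_subfield F"
    and subfield_E: "is_subfield E"
    and F_subset_E: "F \<subseteq> E"
    and finite_I: "finite I"
    and t_in_E: "i \<in> I \<Longrightarrow> t i \<in> E"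
    and t_nonzero: "i \<in> I \<Longrightarrow> t i \<noteq> 0"
    and independent: "\<lbrakk>\<And>i. i \<in> I \<Longrightarrow> c i \<in> F; i \<in> I\<rbrakk> \<Longrightarrow> v (\<Sum>i\<in>I. c i * t i) \<le> v (c i * t i)"
    and approximation: "\<lbrakk>y \<in> E; y \<noteq> 0\<rbrakk> \<Longrightarrow>
      \<exists>c. (\<forall>i\<in>I. c i \<in> F) \<and> v y < v (y - (\<Sum>i\<in>I. c i * t i))"
begin

definition index_class :: "'f \<Rightarrow> 'i set" where
  "index_class z = {i \<in> I. \<exists>c\<in>F. v (c * t i) = v z}"

text \<open>
  Only the \<open>t i\<close> whose value is congruent to \<open>v z\<close> modulo \<open>vF\<close> contribute to the leading part of an
  element of value \<open>v z\<close>.  Rescaled by elements of \<open>F\<close> to have value exactly \<open>v z\<close> and divided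
  by \<open>z\<close>, they become units, and their residues are a basis of \<open>Ev\<close> over \<open>Fv\<close>: independence and
  approximation for the value \<open>v z\<close> turn, after division by \<open>z\<close>, into linear independence
  and generation in the residue field.
\<close>

lemma dimension_residue_field:
  assumes z: "z \<in> E" "z \<noteq> 0"
  shows "ring.dimension (residue_field v) (card (index_class z))
           (residue_subfield v F) (residue_subfield v E)"
proof -
  interpret k: cring "residue_field v" by (rule cring_residue_field)
  let ?J = "index_class z"
  note Fv = subfield_residue_subfield[OF subfield_F]
  note clF = is_subfieldD[OF subfield_F] and clE = is_subfieldD[OF subfield_E]
  have J: "finite ?J" "?J \<subseteq> I"
    using finite_I by (auto simp: index_class_def)
  obtain js where js: "set js = ?J" "distinct js"
    using finite_distinct_list[OF J(1)] by blast
  have "\<forall>i\<in>?J. \<exists>b\<in>F. v (b * t i) = v z"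
    by (auto simp: index_class_def)
  then obtain b where b: "\<And>i. i \<in> ?J \<Longrightarrow> b i \<in> F \<and> v (b i * t i) = v z"
    by metis
  have b0: "b i \<noteq> 0" if "i \<in> ?J" for i
  proof -
    have "v (b i * t i) \<noteq> Pinf"
      using b[OF that] z by simp
    thus ?thesis by auto
  qed
  define u where "u = (\<lambda>i. b i * t i / z)"
  have u: "v (u i) = 0" "u i \<in> E" if "i \<in> ?J" for i
    using b[OF that] z J(2) that F_subset_E t_in_E
    by (auto simp: u_def v_divide_self intro!: clE)
  have us: "set (map (residue \<circ> u) js) \<subseteq> carrier (residue_field v)"
    using u js by (auto simp: residue_ops(3)[where y = 1])
  have "k.independent (residue_subfield v F) (map (residue \<circ> u) js)"
  proof (cases "js = []")
    case False
    show ?thesis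
    proof (rule ccontr)
      assume "k.dependent (residue_subfield v F) (map (residue \<circ> u) js)"
      then obtain ks where ks: "length ks = length (map (residue \<circ> u) js)"
          "k.combine ks (map (residue \<circ> u) js) = \<zero>\<^bsub>residue_field v\<^esub>"
          "set ks \<subseteq> residue_subfield v F" "set ks \<noteq> {\<zero>\<^bsub>residue_field v\<^esub>}"
        using k.dependent_imp_non_trivial_combine[OF Fv us] by metis
      obtain c where c: "\<And>i. i \<in> set js \<Longrightarrow> c i \<in> F \<and> 0 \<le> v (c i)" "ks = map (residue \<circ> c) js"
        using residue_subfield_lists[OF ks(3) _ js(2)] ks(1) by auto
      have nonneg: "0 \<le> v (\<Sum>i\<in>?J. c i * u i)"
        using c u js by (intro v_sum_ge v_mult_nonneg) auto
      have "residue (\<Sum>i\<in>?J. c i * u i) = \<zero>\<^bsub>residue_field v\<^esub>"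
        using ks(2) combine_residue[of js c u] c u js by simp
      hence "0 < v (\<Sum>i\<in>?J. c i * u i)"
        using residue_eq_0_iff[OF nonneg] by simp
      hence "v z < v (z * (\<Sum>i\<in>?J. c i * u i))"
        using v_mult_less_cancel[of z 1] z by simp
      also have "z * (\<Sum>i\<in>?J. c i * u i) = (\<Sum>i\<in>?J. (c i * b i) * t i)"
        using z by (simp add: sum_distrib_left u_def mult.assoc)
      also have "\<dots> = (\<Sum>i\<in>I. (if i \<in> ?J then c i * b i else 0) * t i)"
        using J finite_I by (intro sum.mono_neutral_cong_left) auto
      finally have less: "v z < v (\<Sum>i\<in>I. (if i \<in> ?J then c i * b i else 0) * t i)" .
      \<comment> \<open>No cancellation: the sum has value above \<open>v z\<close>, so every term does, and \<open>b i * t i\<close> has value \<open>v z\<close>.\<close>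
      have pos: "0 < v (c i)" if i: "i \<in> ?J" for i
      proof -
        note less
        also have "v (\<Sum>i\<in>I. (if i \<in> ?J then c i * b i else 0) * t i) \<le>
            v ((if i \<in> ?J then c i * b i else 0) * t i)"
          using c b js i J clF by (intro independent) (auto intro: clF)
        finally have "v (b i * t i * 1) < v (b i * t i * c i)"
          using i b[OF i] by (simp add: mult_ac)
        thus ?thesis
          using v_mult_less_cancel[of "b i * t i" 1 "c i"] b0[OF i] t_nonzero[of i] i J by auto
      qed
      have "residue (c i) = \<zero>\<^bsub>residue_field v\<^esub>" if "i \<in> ?J" for i
        using pos[OF that] residue_eq_0_iff[of "c i"] by auto
      hence "set ks \<subseteq> {\<zero>\<^bsub>residue_field v\<^esub>}"
        using c(2) js by auto
      moreover have "ks \<noteq> []" using ks(1) False by auto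
      ultimately show False using ks(4) by (cases ks) auto
    qed
  qed auto
  moreover have "k.Span (residue_subfield v F) (map (residue \<circ> u) js) = residue_subfield v E"
  proof (intro equalityI subsetI)
    fix x assume "x \<in> k.Span (residue_subfield v F) (map (residue \<circ> u) js)"
    then obtain ks where ks: "set ks \<subseteq> residue_subfield v F"
        "length ks = length (map (residue \<circ> u) js)" "x = k.combine ks (map (residue \<circ> u) js)"
      using k.Span_mem_iff_length_version[OF Fv us] by auto
    obtain c where c: "\<And>i. i \<in> set js \<Longrightarrow> c i \<in> F \<and> 0 \<le> v (c i)" "ks = map (residue \<circ> c) js"
      using residue_subfield_lists[OF ks(1) _ js(2)] ks(2) by auto
    have "x = residue (\<Sum>i\<in>?J. c i * u i)"
      using ks(3) combine_residue[of js c u] c u js by simp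
    moreover have "0 \<le> v (\<Sum>i\<in>?J. c i * u i)"
      using c u js by (intro v_sum_ge v_mult_nonneg) auto
    moreover have "(\<Sum>i\<in>?J. c i * u i) \<in> E"
      using c(1) js
      by (intro is_subfield_sum[OF subfield_E] clE(4) subsetD[OF F_subset_E] u(2)) auto
    ultimately show "x \<in> residue_subfield v E"
      by (auto simp: residue_subfield_eq)
  next
    fix x assume "x \<in> residue_subfield v E"
    then obtain y where y: "y \<in> E" "0 \<le> v y" "x = residue y"
      by (auto simp: residue_subfield_eq)
    have "\<exists>c. (\<forall>i\<in>?J. c i \<in> F \<and> 0 \<le> v (c i)) \<and> 0 < v (y - (\<Sum>i\<in>?J. c i * u i))"
    proof (cases "0 < v y")
      case True
      thus ?thesis by (intro exI[of _ "\<lambda>_. 0"]) (auto intro: clF)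
    next
      case False
      hence vy: "v y = 0" "y \<noteq> 0" using y(2) by (auto simp: zero_extended_def)
      have vyz: "v (y * z) = v z" using vy by (simp add: v_mult)
      obtain c where c: "\<forall>i\<in>I. c i \<in> F" "v z < v (y * z - (\<Sum>i\<in>I. c i * t i))"
        using approximation[of "y * z"] vy y z clE(4)[of y z] vyz by auto
      have "v (\<Sum>i\<in>I. c i * t i) = v (y * z)"
        using c(2) vyz by (intro v_close_eq) simp
      hence ge: "v z \<le> v (c i * t i)" if "i \<in> I" for i
        using independent[of c i] c(1) that vyz by simp
      \<comment> \<open>Outside of the class no term can have value exactly \<open>v z\<close>, so it is part of the error.\<close>
      have "v z < v (c i * t i)" if "i \<in> I - ?J" for i
        using ge[of i] that c(1) by (auto simp: index_class_def less_le)
      hence "v z < v (\<Sum>i\<in>I - ?J. c i * t i)"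
        using z by (intro v_sum_gt) auto
      hence "v z < v (y * z - (\<Sum>i\<in>I. c i * t i) + (\<Sum>i\<in>I - ?J. c i * t i))"
        using c(2) by (rule v_add_gt[rotated])
      also have "y * z - (\<Sum>i\<in>I. c i * t i) + (\<Sum>i\<in>I - ?J. c i * t i) =
          y * z - (\<Sum>i\<in>?J. c i * t i)"
        using sum.subset_diff[OF J(2) finite_I, of "\<lambda>i. c i * t i"] by simp
      also have "(\<Sum>i\<in>?J. c i * t i) = (\<Sum>i\<in>?J. z * (c i / b i * u i))"
        using b0 z by (intro sum.cong) (auto simp: u_def)
      also have "y * z - \<dots> = z * (y - (\<Sum>i\<in>?J. c i / b i * u i))"
        by (simp add: sum_distrib_left algebra_simps)
      finally have "0 < v (y - (\<Sum>i\<in>?J. c i / b i * u i))"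
        using v_mult_less_cancel[of z 1] z by simp
      moreover have "c i / b i \<in> F \<and> 0 \<le> v (c i / b i)" if i: "i \<in> ?J" for i
      proof -
        have "i \<in> I" using i J(2) by blast
        have "v (b i * t i * 1) \<le> v (c i * t i)"
          using ge[OF \<open>i \<in> I\<close>] b[OF i] by simp
        also have "c i * t i = b i * t i * (c i / b i)"
          using b0[OF i] by simp
        finally have "0 \<le> v (c i / b i)"
          by (subst (asm) v_mult_le_cancel) (use b0[OF i] t_nonzero[OF \<open>i \<in> I\<close>] in auto)
        thus ?thesis using c(1) b[OF i] i J(2) by (auto intro: clF)
      qed
      ultimately show ?thesis
        by (intro exI[of _ "\<lambda>i. c i / b i"]) auto
    qed
    then obtain c where c: "\<And>i. i \<in> ?J \<Longrightarrow> c i \<in> F \<and> 0 \<le> v (c i)"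
      "0 < v (y - (\<Sum>i\<in>?J. c i * u i))" by blast
    have "0 \<le> v (\<Sum>i\<in>?J. c i * u i)"
      using c u js by (intro v_sum_ge v_mult_nonneg) auto
    hence "x = residue (\<Sum>i\<in>?J. c i * u i)"
      using residue_eq_iff c(2) y by simp
    also have "\<dots> = k.combine (map (residue \<circ> c) js) (map (residue \<circ> u) js)"
      using combine_residue[of js c u] c u js by simp
    finally show "x \<in> k.Span (residue_subfield v F) (map (residue \<circ> u) js)"
      unfolding k.Span_mem_iff_length_version[OF Fv us] using c js
      by (intro exI[of _ "map (residue \<circ> c) js"]) (auto simp: residue_subfield_eq)
  qed
  ultimately have "k.dimension (length (map (residue \<circ> u) js))
      (residue_subfield v F) (residue_subfield v E)"
    by (rule k.dimensionI[OF Fv])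
  thus ?thesis using js distinct_card[of js] by simp
qed

text \<open>
  The previous basis has the same length for every \<open>z\<close>, namely the residue degree; this degree is
  positive because the residue of \<open>1\<close> is not zero.
\<close>

lemma card_index_class:
  assumes z: "z \<in> E" "z \<noteq> 0"
  shows "ext_degree (residue_field v) (residue_subfield v F) (residue_subfield v E)
           = card (index_class z)"
    and "index_class z \<noteq> {}"
proof -
  interpret k: cring "residue_field v" by (rule cring_residue_field)
  note Fv = subfield_residue_subfield[OF subfield_F]
  note dim = dimension_residue_field[OF z]
  show "ext_degree (residue_field v) (residue_subfield v F) (residue_subfield v E)
           = card (index_class z)"
    using k.dimI[OF Fv dim] k.finite_dimensionI[OF dim] by (simp add: ext_degree_def over_def)
  show "index_class z \<noteq> {}"
  proof
    assume "index_class z = {}"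
    hence "residue_subfield v E = {\<zero>\<^bsub>residue_field v\<^esub>}"
      using dim k.dimension_zero[OF Fv] by simp
    moreover have "residue 1 \<in> residue_subfield v E"
      using is_subfieldD(2)[OF subfield_E] by (auto simp: residue_subfield_eq)
    ultimately show False using residue_eq_0_iff[of 1] by simp
  qed
qed

text \<open>
  The index set falls into the classes given by the cosets of \<open>vF\<close> in \<open>vE\<close>.  Each coset occurs, and
  each class has as many elements as the residue degree.
\<close>

theorem index_times_degree:
  "group_index (value_group v E) (carrier (value_group v F)) *
     ext_degree (residue_field v) (residue_subfield v F) (residue_subfield v E) = card I"
proof -
  let ?H = "carrier (value_group v F)"
  let ?f = "ext_degree (residue_field v) (residue_subfield v F) (residue_subfield v E)"
  note clF = is_subfieldD[OF subfield_F] and clE = is_subfieldD[OF subfield_E]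
  \<comment> \<open>Cosets are indexed by field elements instead of values: this is the coset of \<open>v x\<close>.\<close>
  define coset where "coset x = {h + g | h g. h \<in> ?H \<and> v x = Fin g}" for x
  have coset_iff: "coset x = coset y \<longleftrightarrow> (\<exists>c\<in>F. v (c * y) = v x)"
    if x: "x \<noteq> 0" and y: "y \<noteq> 0" for x y
  proof -
    obtain g h where gh: "v x = Fin g" "v y = Fin h"
      using v_finite x y by metis
    show ?thesis
    proof
      assume "coset x = coset y"
      moreover have "g \<in> coset x"
        using gh clF(2) v_1 by (auto simp: coset_def value_group_def zero_extended_def
            intro!: exI[of _ 0] bexI[of _ 1])
      ultimately obtain c where "c \<in> F" "v c = Fin (g - h)"
        using gh by (auto simp: coset_def value_group_def)
      thus "\<exists>c\<in>F. v (c * y) = v x"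
        using gh by (intro bexI[of _ c]) (simp_all add: v_mult)
    next
      assume "\<exists>c\<in>F. v (c * y) = v x"
      then obtain c where c: "c \<in> F" "v (c * y) = v x" by blast
      then obtain d where d: "v c = Fin d" "g = d + h"
        using gh by (cases "v c") (auto simp: v_mult)
      have "k + d \<in> ?H" "k - d \<in> ?H" if "k \<in> ?H" for k
      proof -
        obtain b where b: "b \<in> F" "v b = Fin k"
          using \<open>k \<in> ?H\<close> by (auto simp: value_group_def)
        show "k + d \<in> ?H"
          using b c d clF(4)[of b c] by (auto simp: value_group_def v_mult intro!: bexI[of _ "b * c"])
        show "k - d \<in> ?H"
          using b c d clF(8)[of b c] v_divide_Fin[OF b(2) d(1)]
          by (auto simp: value_group_def)
      qed
      note H = this
      show "coset x = coset y"
      proof (intro equalityI subsetI)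
        fix w assume "w \<in> coset x"
        then obtain k where "k \<in> ?H" "w = k + (d + h)" using gh d by (auto simp: coset_def)
        thus "w \<in> coset y" using H(1)[of k] gh by (auto simp: coset_def add.assoc[symmetric])
      next
        fix w assume "w \<in> coset y"
        then obtain k where "k \<in> ?H" "w = k + h" using gh d by (auto simp: coset_def)
        hence "k - d \<in> ?H" "w = (k - d) + g" using H(2)[of k] d by (auto simp: algebra_simps)
        thus "w \<in> coset x" using gh by (auto simp: coset_def)
      qed
    qed
  qed
  have r_coset: "?H #>\<^bsub>value_group v E\<^esub> g = coset x" if "v x = Fin g" for x g
    using that by (auto simp: r_coset_def value_group_def coset_def)
  have vE: "carrier (value_group v E) = {g. \<exists>x\<in>E - {0}. v x = Fin g}"
    by (force simp: value_group_def)
  have cosets: "rcosets\<^bsub>value_group v E\<^esub> ?H = coset ` (E - {0})"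
  proof (intro equalityI subsetI)
    fix C assume "C \<in> rcosets\<^bsub>value_group v E\<^esub> ?H"
    then obtain x g where "x \<in> E - {0}" "v x = Fin g" "C = ?H #>\<^bsub>value_group v E\<^esub> g"
      unfolding RCOSETS_def vE by blast
    thus "C \<in> coset ` (E - {0})" using r_coset by blast
  next
    fix C assume "C \<in> coset ` (E - {0})"
    then obtain x where x: "x \<in> E - {0}" "C = coset x" by blast
    moreover obtain g where "v x = Fin g" using v_finite[of x] x(1) by auto
    ultimately show "C \<in> rcosets\<^bsub>value_group v E\<^esub> ?H"
      unfolding RCOSETS_def vE using r_coset[of x g] by blast
  qed
  have idx: "index_class z = {i \<in> I. coset (t i) = coset z}" if "z \<in> E" "z \<noteq> 0" for z
  proof -
    have "coset (t i) = coset z \<longleftrightarrow> (\<exists>c\<in>F. v (c * t i) = v z)" if "i \<in> I" for i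
      using coset_iff[of z "t i"] t_nonzero[OF that] \<open>z \<noteq> 0\<close> by metis
    thus ?thesis by (auto simp: index_class_def)
  qed
  have image: "coset ` (E - {0}) = (\<lambda>i. coset (t i)) ` I"
  proof (intro equalityI subsetI)
    fix C assume "C \<in> coset ` (E - {0})"
    then obtain z where z: "z \<in> E" "z \<noteq> 0" "C = coset z" by auto
    thus "C \<in> (\<lambda>i. coset (t i)) ` I"
      using card_index_class(2)[of z] idx[of z] by auto
  qed (use t_in_E t_nonzero in auto)
  have "card I = (\<Sum>C\<in>(\<lambda>i. coset (t i)) ` I. card {i \<in> I. coset (t i) = C})"
    using sum.image_gen[OF finite_I, of "\<lambda>_. 1::nat" "\<lambda>i. coset (t i)"] by simp
  also have "\<dots> = (\<Sum>C\<in>(\<lambda>i. coset (t i)) ` I. ?f)"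
  proof (rule sum.cong[OF refl])
    fix C assume "C \<in> (\<lambda>i. coset (t i)) ` I"
    then obtain i where i: "i \<in> I" "C = coset (t i)" by blast
    show "card {i \<in> I. coset (t i) = C} = ?f"
      using idx[OF t_in_E t_nonzero] card_index_class(1)[OF t_in_E t_nonzero] i by simp
  qed
  also have "\<dots> = card (coset ` (E - {0})) * ?f"
    by (simp add: image)
  finally show ?thesis
    by (simp add: group_index_def cosets)
qed

end

section \<open>Taylor expansions in the rational function field\<close>

lemma const_simps:
  "const 0 = 0" "const 1 = 1" "const (x + y) = const x + const y" "const (x - y) = const x - const y"
  "const (- x) = - const x" "const (x * y) = const x * const y"
proof -
  show "const 0 = 0" by simp
  show "const 1 = 1" by (metis one_pCons to_fract_1)
  show "const (x + y) = const x + const y" by (simp flip: to_fract_add)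
  show "const (x - y) = const x - const y" by (simp flip: to_fract_diff)
  show "const (- x) = - const x" by (simp flip: to_fract_uminus)
  show "const (x * y) = const x * const y" by (simp flip: to_fract_mult)
qed

lemma to_fract_power: "to_fract (p ^ n) = to_fract p ^ n"
  by (induction n) simp_all

lemma indet_minus_const: "indet - const c = to_fract [:- c, 1:]"
  by (simp flip: to_fract_diff)

text \<open>
  The terms of the expansion around \<open>a\<close> are taken as elements of the rational function field, with
  the power of \<open>X - a\<close> included.  In this way values such as \<open>v c + m \<gamma>\<close> are values of
  elements and need no multiplication of \<open>\<gamma>\<close> by natural numbers.
\<close>

definition taylor_term :: "'a::field \<Rightarrow> 'a poly \<Rightarrow> nat \<Rightarrow> 'a poly fract" where
  "taylor_term a p m = const (coeff (p \<circ>\<^sub>p [:a, 1:]) m) * (indet - const a) ^ m"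

lemma taylor_term_add: "taylor_term a (p + q) m = taylor_term a p m + taylor_term a q m"
  and taylor_term_diff: "taylor_term a (p - q) m = taylor_term a p m - taylor_term a q m"
  and taylor_term_smult: "taylor_term a (smult c p) m = const c * taylor_term a p m"
  by (simp_all add: taylor_term_def pcompose_add pcompose_diff pcompose_smult const_simps algebra_simps)

lemma taylor_term_linear_mult:
  "taylor_term a ([:- b, 1:] * p) m = const (a - b) * taylor_term a p m +
     (if m = 0 then 0 else (indet - const a) * taylor_term a p (m - 1))"
proof -
  have "([:- b, 1:] * p) \<circ>\<^sub>p [:a, 1:] =
      smult (a - b) (p \<circ>\<^sub>p [:a, 1:]) + pCons 0 (p \<circ>\<^sub>p [:a, 1:])"
    by (simp only: pcompose_mult) (simp add: pcompose_pCons)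
  thus ?thesis
    unfolding taylor_term_def
    by (cases m) (simp_all add: const_simps(3-6) algebra_simps)
qed

lemma taylor_term_const: "taylor_term a [:c:] m = (if m = 0 then const c else 0)"
  by (cases m) (simp_all add: taylor_term_def)

lemma taylor_term_0: "taylor_term a p 0 = const (poly p a)"
  by (simp add: taylor_term_def poly_pcompose flip: poly_0_coeff_0)

lemma taylor_expansion: "to_fract p = (\<Sum>m\<le>degree p. taylor_term a p m)"
proof -
  define q where "q = p \<circ>\<^sub>p [:a, 1:]"
  have deg: "degree q = degree p"
    by (simp add: q_def degree_pcompose)
  have "p = q \<circ>\<^sub>p [:- a, 1:]"
    by (simp add: q_def pcompose_assoc[symmetric] pcompose_pCons)
  also have "\<dots> = (\<Sum>m\<le>degree p. [:coeff q m:] * [:- a, 1:] ^ m)"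
    by (simp add: pcompose_altdef poly_altdef coeff_map_poly degree_map_poly deg)
  finally have "to_fract p = to_fract (\<Sum>m\<le>degree p. [:coeff q m:] * [:- a, 1:] ^ m)"
    by simp
  thus ?thesis
    by (simp only: to_fract_sum to_fract_mult to_fract_power taylor_term_def indet_minus_const q_def)
qed

section \<open>Initial degrees of polynomials\<close>

text \<open>
  The first condition on a minimal pair, without a name for the value \<open>\<gamma>\<close> of \<open>X - a\<close>.  It
  determines \<open>v\<close> on linear polynomials and hence, as constants are algebraically closed, from the
  values of constants.
\<close>

locale maximal_centre = valued_field v
  for v :: "'a::alg_closed_field poly fract \<Rightarrow> 'g::linordered_ab_group_add extended" +
  fixes a :: 'a
  assumes maximal: "v (indet - const c) \<le> v (indet - const a)"
begin

abbreviation T :: "'a poly fract" where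
  "T \<equiv> indet - const a"

abbreviation w :: "'a poly \<Rightarrow> 'g extended" where
  "w p \<equiv> v (to_fract p)"

abbreviation near :: "'a \<Rightarrow> bool" where
  "near b \<equiv> v T \<le> v (const (a - b))"

text \<open>
  By \<open>taylor_term_bounds\<close> below this is the degree in \<open>T\<close> of the leading part of \<open>p\<close>: the largest
  \<open>m\<close> for which the \<open>m\<close>-th Taylor term has the same value as \<open>p\<close>.  The definition by roots makes
  it evidently additive on products.
\<close>

definition initial_degree :: "'a poly \<Rightarrow> nat" where
  "initial_degree p = size (filter_mset near (proots p))"

lemma T_nonzero: "T \<noteq> 0"
  by (simp add: indet_minus_const)

lemma w_near: "near b \<Longrightarrow> w [:- b, 1:] = v T"
  and w_far: "\<not> near b \<Longrightarrow> w [:- b, 1:] = v (const (a - b))"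
proof -
  have eq: "to_fract [:- b, 1:] = T + const (a - b)"
    by (simp add: const_simps flip: indet_minus_const)
  show "w [:- b, 1:] = v T" if "near b"
  proof (rule antisym)
    show "w [:- b, 1:] \<le> v T"
      using maximal[of b] by (simp only: indet_minus_const)
    show "v T \<le> w [:- b, 1:]"
      unfolding eq using that by (intro v_add_ge) auto
  qed
  show "w [:- b, 1:] = v (const (a - b))" if "\<not> near b"
    using that v_add_eq[of "const (a - b)" T] by (simp add: eq add.commute)
qed

lemma initial_degree_mult:
  "p \<noteq> 0 \<Longrightarrow> q \<noteq> 0 \<Longrightarrow> initial_degree (p * q) = initial_degree p + initial_degree q"
  by (simp add: initial_degree_def proots_mult)

lemma initial_degree_const [simp]: "initial_degree [:c:] = 0"
  by (simp add: initial_degree_def)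

lemma initial_degree_power: "p \<noteq> 0 \<Longrightarrow> initial_degree (p ^ n) = n * initial_degree p"
  using initial_degree_const[of 1] by (induction n) (simp_all add: initial_degree_mult one_pCons)

lemma initial_degree_linear: "initial_degree [:- b, 1:] = (if near b then 1 else 0)"
  by (simp add: initial_degree_def)

text \<open>
  The value of a polynomial is the minimum of the values of its Taylor terms at \<open>a\<close>, and the last
  term that attains the minimum is counted by the roots near \<open>a\<close>.  Multiplication by \<open>X - b\<close>, which is
  \<open>T + (a - b)\<close>, preserves this: if \<open>b\<close> is near, \<open>T\<close> has the value of the factor and
  shifts the last minimal term by one; if not, the constant has strictly smaller value than \<open>T\<close> and
  leaves it where it is.
\<close>

lemma taylor_term_bounds:
  assumes "p \<noteq> 0"
  shows "w p \<le> v (taylor_term a p m)"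
    and "initial_degree p < m \<Longrightarrow> w p < v (taylor_term a p m)"
    and "v (taylor_term a p (initial_degree p)) = w p"
proof -
  have "(\<forall>m. w p \<le> v (taylor_term a p m) \<and> (initial_degree p < m \<longrightarrow> w p < v (taylor_term a p m))) \<and>
        v (taylor_term a p (initial_degree p)) = w p"
    using assms
  proof (induction "degree p" arbitrary: p)
    case 0
    then obtain c where c: "p = [:c:]" "c \<noteq> 0"
      by (metis degree_eq_zeroE pCons_eq_0_iff)
    thus ?case by (auto simp: taylor_term_const)
  next
    case (Suc n p)
    obtain b where "poly p b = 0"
      using alg_closed_imp_poly_has_root[of p] Suc.hyps(2) by auto
    then obtain q where q: "p = [:- b, 1:] * q"
      using poly_eq_0_iff_dvd by (metis dvdE)
    have q0: "q \<noteq> 0" using q Suc.prems by auto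
    have "n = degree q"
      using Suc.hyps(2) q q0 by (simp add: degree_mult_eq del: mult_pCons_left)
    note IH = Suc.hyps(1)[OF this q0]
    hence ge: "w q \<le> v (taylor_term a q m)"
      and gt: "initial_degree q < m \<Longrightarrow> w q < v (taylor_term a q m)"
      and eq: "v (taylor_term a q (initial_degree q)) = w q" for m
      by auto
    have w: "w p = v (to_fract [:- b, 1:] * to_fract q)"
      by (simp only: q to_fract_mult)
    have deg: "initial_degree p = initial_degree q + (if near b then 1 else 0)"
      unfolding q using initial_degree_mult[of "[:- b, 1:]" q] q0 by (simp add: initial_degree_linear)
    note term_p = taylor_term_linear_mult[of a b q, folded q]
    show ?case
    proof (cases "near b")
      case True
      hence w: "w p = v (T * to_fract q)"
        using w_near[OF True] w by (simp add: v_mult)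
      have 1: "w p \<le> v (const (a - b) * taylor_term a q m)"
          "w p \<le> v (T * taylor_term a q m)" for m
        unfolding w using ge True by (auto intro: v_mult_mono)
      have 2: "w p < v (const (a - b) * taylor_term a q m)"
          "w p < v (T * taylor_term a q m)" if "initial_degree q < m" for m
        unfolding w using gt[OF that] True T_nonzero by (auto intro: v_mult_strict_mono)
      have "w p \<le> v (taylor_term a p m)" for m
        unfolding term_p using 1 by (auto intro!: v_add_ge)
      moreover have "w p < v (taylor_term a p m)" if "initial_degree p < m" for m
        unfolding term_p using that 2[of m] 2[of "m - 1"] True by (auto simp: deg intro!: v_add_gt)
      moreover have "v (taylor_term a p (initial_degree p)) = w p"
      proof -
        have "v (T * taylor_term a q (initial_degree q)) = w p"
          unfolding w using eq by (simp add: v_mult)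
        moreover have "w p < v (const (a - b) * taylor_term a q (Suc (initial_degree q)))"
          by (rule 2) simp
        ultimately show ?thesis
          unfolding term_p using True
            v_add_eq[of "T * taylor_term a q (initial_degree q)"
              "const (a - b) * taylor_term a q (Suc (initial_degree q))"]
          by (simp add: deg add.commute)
      qed
      ultimately show ?thesis by blast
    next
      case False
      hence w: "w p = v (const (a - b) * to_fract q)"
        using w_far[OF False] w by (simp add: v_mult)
      have ab: "const (a - b) \<noteq> 0"
        using False by (intro v_less_nonzero[of _ "v T"]) simp
      have 1: "w p < v (T * taylor_term a q m)" for m
        unfolding w using ge[of m] False ab v_mult_strict_mono[of "to_fract q" "taylor_term a q m" "const (a - b)" T] q0
        by (simp add: mult.commute)
      have 2: "w p < v (const (a - b) * taylor_term a q m)" if "initial_degree q < m" for m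
        unfolding w using gt[OF that] ab by (auto intro: v_mult_strict_mono)
      have 3: "w p \<le> v (const (a - b) * taylor_term a q m)" for m
        unfolding w using ge by (auto intro: v_mult_mono)
      have 4: "v (const (a - b) * taylor_term a q (initial_degree q)) = w p"
        unfolding w using eq by (simp add: v_mult)
      have "w p \<le> v (taylor_term a p m)" for m
        unfolding term_p using v_add_ge[OF 3[of m] less_imp_le[OF 1[of "m - 1"]]] 3[of m]
        by (cases "m = 0") simp_all
      moreover have "w p < v (taylor_term a p m)" if "initial_degree p < m" for m
        unfolding term_p using that 1 2[of m] False by (auto simp: deg intro!: v_add_gt)
      moreover have "v (taylor_term a p (initial_degree p)) = w p"
        unfolding term_p using False 4 1[of "initial_degree q - 1"]
          v_add_eq[of "const (a - b) * taylor_term a q (initial_degree q)"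
            "T * taylor_term a q (initial_degree q - 1)"]
        by (cases "initial_degree q = 0") (simp_all add: deg)
      ultimately show ?thesis by blast
    qed
  qed
  thus "w p \<le> v (taylor_term a p m)"
    "initial_degree p < m \<Longrightarrow> w p < v (taylor_term a p m)"
    "v (taylor_term a p (initial_degree p)) = w p"
    by auto
qed

text \<open>
  A converse to the previous lemma, used to read off value and initial degree of a polynomial that is
  given by its Taylor terms and not by its roots.
\<close>

lemma initial_degree_unique:
  assumes "g \<noteq> Pinf" "\<And>m. g \<le> v (taylor_term a p m)" "v (taylor_term a p d) = g"
    "\<And>m. d < m \<Longrightarrow> g < v (taylor_term a p m)"
  shows "p \<noteq> 0" "w p = g" "initial_degree p = d"
proof -
  show p: "p \<noteq> 0"
    using assms(1,3) by (auto simp: taylor_term_def)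
  show w: "w p = g"
  proof (rule antisym)
    show "w p \<le> g" using taylor_term_bounds(1)[OF p, of d] assms(3) by simp
    show "g \<le> w p" unfolding taylor_expansion[of p a] using assms(2) by (intro v_sum_ge)
  qed
  show "initial_degree p = d"
  proof (rule linorder_cases[of "initial_degree p" d])
    assume "initial_degree p < d"
    thus ?thesis using taylor_term_bounds(2)[OF p, of d] w assms(3) by simp
  next
    assume "d < initial_degree p"
    thus ?thesis using assms(4)[of "initial_degree p"] taylor_term_bounds(3)[OF p] w by simp
  qed
qed

text \<open>
  The leading parts of \<open>p\<close> and \<open>q\<close> have different degrees in \<open>T\<close>, so they cannot cancel.
\<close>

lemma initial_degree_add:
  assumes p: "p \<noteq> 0" and q: "q \<noteq> 0" and neq: "initial_degree p \<noteq> initial_degree q"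
  shows "p + q \<noteq> 0" "w (p + q) = min (w p) (w q)"
    "initial_degree (p + q) \<in> {initial_degree p, initial_degree q}"
proof -
  \<comment> \<open>The leading term of \<open>p\<close> survives if \<open>p\<close> has smaller value, or equal value and larger initial degree.\<close>
  have *: "p + q \<noteq> 0 \<and> w (p + q) = w p \<and> initial_degree (p + q) = initial_degree p"
    if p: "p \<noteq> 0" and q: "q \<noteq> 0"
      and less: "w p < w q \<or> w p = w q \<and> initial_degree q < initial_degree p" for p q
  proof -
    have above: "w p < v (taylor_term a q m)" if "initial_degree p \<le> m" for m
      using less taylor_term_bounds(1,2)[OF q, of m] that by (auto dest: less_le_trans)
    have eq: "v (taylor_term a p (initial_degree p) + taylor_term a q (initial_degree p)) = w p"
      using v_add_eq[of "taylor_term a p (initial_degree p)" "taylor_term a q (initial_degree p)"]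
        above[of "initial_degree p"] taylor_term_bounds(3)[OF p] by simp
    have ge: "w p \<le> v (taylor_term a p m + taylor_term a q m)" for m
      using less taylor_term_bounds(1)[OF q, of m] taylor_term_bounds(1)[OF p, of m]
      by (intro v_add_ge) auto
    have gt: "w p < v (taylor_term a p m + taylor_term a q m)" if "initial_degree p < m" for m
      using above[of m] taylor_term_bounds(2)[OF p that] that by (intro v_add_gt) auto
    show ?thesis
      using initial_degree_unique[of "w p" "p + q" "initial_degree p", unfolded taylor_term_add]
        eq ge gt p by simp
  qed
  consider "w p < w q \<or> w p = w q \<and> initial_degree q < initial_degree p"
    | "w q < w p \<or> w q = w p \<and> initial_degree p < initial_degree q"
    using neq by force
  hence "p + q \<noteq> 0 \<and> w (p + q) = min (w p) (w q) \<and>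
      initial_degree (p + q) \<in> {initial_degree p, initial_degree q}"
  proof cases
    case 1
    thus ?thesis using *[OF p q] by (auto simp: min_def)
  next
    case 2
    thus ?thesis using *[OF q p] by (auto simp: min_def add.commute)
  qed
  thus "p + q \<noteq> 0" "w (p + q) = min (w p) (w q)"
    "initial_degree (p + q) \<in> {initial_degree p, initial_degree q}" by auto
qed

lemma w_sum_le:
  assumes "finite S" "\<And>i. i \<in> S \<Longrightarrow> p i \<noteq> 0"
    "\<And>i k. i \<in> S \<Longrightarrow> k \<in> S \<Longrightarrow> initial_degree (p i) = initial_degree (p k) \<Longrightarrow> i = k" "i \<in> S"
  shows "w (\<Sum>i\<in>S. p i) \<le> w (p i)"
proof -
  have "S \<noteq> {} \<longrightarrow> (\<Sum>i\<in>S. p i) \<noteq> 0 \<and> (\<forall>i\<in>S. w (\<Sum>i\<in>S. p i) \<le> w (p i)) \<and>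
      initial_degree (\<Sum>i\<in>S. p i) \<in> (\<lambda>i. initial_degree (p i)) ` S"
    using assms(1-3)
  proof (induction S)
    case (insert x S)
    show ?case
    proof (cases "S = {}")
      case False
      let ?s = "\<Sum>i\<in>S. p i"
      have IH: "?s \<noteq> 0" "\<And>i. i \<in> S \<Longrightarrow> w ?s \<le> w (p i)"
        "initial_degree ?s \<in> (\<lambda>i. initial_degree (p i)) ` S"
        using insert.IH insert.prems False by (simp_all add: Ball_def)
      have neq: "initial_degree (p x) \<noteq> initial_degree ?s"
      proof
        assume "initial_degree (p x) = initial_degree ?s"
        then obtain i where "i \<in> S" "initial_degree (p x) = initial_degree (p i)"
          using IH(3) by auto
        thus False using insert.prems(2)[of x i] insert.hyps(2) by auto
      qed
      have px: "p x \<noteq> 0" using insert.prems(1) by simp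
      note add = initial_degree_add[OF px IH(1) neq]
      have sum: "(\<Sum>i\<in>insert x S. p i) = p x + ?s"
        using insert.hyps by simp
      have "w (p x + ?s) \<le> w (p i)" if "i \<in> insert x S" for i
        using that IH(2)[of i] add(2) by (auto simp: min_le_iff_disj)
      thus ?thesis
        unfolding sum using add(1,3) IH(3) by auto
    qed (use insert in simp)
  qed simp
  thus ?thesis using assms(4) by blast
qed

text \<open>
  All Taylor terms but the constant one, which is the value at \<open>a\<close>, lie above the initial degree.
\<close>

lemma close_to_value:
  assumes "p \<noteq> 0" "initial_degree p = 0"
  shows "w p < v (to_fract p - const (poly p a))"
proof -
  have "to_fract p = (\<Sum>m\<in>{..degree p} - {0}. taylor_term a p m) + taylor_term a p 0"
    unfolding taylor_expansion[of p a] by (subst sum.remove[of _ 0]) (simp_all add: add.commute)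
  hence "to_fract p - const (poly p a) = (\<Sum>m\<in>{..degree p} - {0}. taylor_term a p m)"
    by (simp add: taylor_term_0)
  also have "w p < v \<dots>"
    using assms taylor_term_bounds(2)[OF assms(1)] by (intro v_sum_gt) auto
  finally show ?thesis .
qed

end

section \<open>Polynomials and fractions over a subfield\<close>

definition polys_over :: "'a::field set \<Rightarrow> 'a poly set" where
  "polys_over F = {p. \<forall>i. coeff p i \<in> F}"

lemma polys_overD: "p \<in> polys_over F \<Longrightarrow> coeff p i \<in> F"
  by (simp add: polys_over_def)

context
  fixes F :: "'a::field set"
  assumes F: "is_subfield F"
begin

lemma polys_over_const: "[:c:] \<in> polys_over F \<longleftrightarrow> c \<in> F"
  using is_subfieldD[OF F] by (auto simp: polys_over_def coeff_pCons split: nat.splits)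

lemma polys_over_0: "0 \<in> polys_over F" and polys_over_1: "1 \<in> polys_over F"
  using is_subfieldD[OF F] by (auto simp: polys_over_def)

lemma polys_over_pCons: "c \<in> F \<Longrightarrow> p \<in> polys_over F \<Longrightarrow> pCons c p \<in> polys_over F"
  by (auto simp: polys_over_def coeff_pCons split: nat.splits)

lemma polys_over_add: "p \<in> polys_over F \<Longrightarrow> q \<in> polys_over F \<Longrightarrow> p + q \<in> polys_over F"
  and polys_over_diff: "p \<in> polys_over F \<Longrightarrow> q \<in> polys_over F \<Longrightarrow> p - q \<in> polys_over F"
  and polys_over_minus: "p \<in> polys_over F \<Longrightarrow> - p \<in> polys_over F"
  using is_subfieldD[OF F] by (auto simp: polys_over_def)

lemma polys_over_mult: "p \<in> polys_over F \<Longrightarrow> q \<in> polys_over F \<Longrightarrow> p * q \<in> polys_over F"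
  using is_subfieldD(4)[OF F] by (auto simp: polys_over_def coeff_mult intro!: is_subfield_sum[OF F])

lemma polys_over_power: "p \<in> polys_over F \<Longrightarrow> p ^ n \<in> polys_over F"
  by (induction n) (auto intro: polys_over_mult polys_over_1)

lemma polys_over_monom: "c \<in> F \<Longrightarrow> monom c n \<in> polys_over F"
  using is_subfieldD(1)[OF F] by (auto simp: polys_over_def)

lemma polys_over_pcompose: "p \<in> polys_over F \<Longrightarrow> q \<in> polys_over F \<Longrightarrow> p \<circ>\<^sub>p q \<in> polys_over F"
proof (induction p)
  case (pCons c p)
  hence "c \<in> F" "p \<in> polys_over F"
    using polys_overD[of "pCons c p" F] by (auto simp: polys_over_def coeff_pCons split: nat.splits)
  thus ?case
    using pCons by (auto simp: pcompose_pCons polys_over_const intro!: polys_over_add polys_over_mult)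
qed (simp add: polys_over_0)

lemma polys_over_div_mod:
  assumes f: "f \<in> polys_over F" "f \<noteq> 0" and p: "p \<in> polys_over F"
  obtains q r where "q \<in> polys_over F" "r \<in> polys_over F" "p = q * f + r"
    "r = 0 \<or> degree r < degree f"
proof -
  have "\<exists>q r. q \<in> polys_over F \<and> r \<in> polys_over F \<and> p = q * f + r \<and> (r = 0 \<or> degree r < degree f)"
    using p
  proof (induction "degree p" arbitrary: p rule: less_induct)
    case less
    show ?case
    proof (cases "p = 0 \<or> degree p < degree f")
      case True
      thus ?thesis
        using less.prems by (intro exI[of _ 0] exI[of _ p]) (auto intro: polys_over_0)
    next
      case False
      define m where "m = monom (lead_coeff p / lead_coeff f) (degree p - degree f)"
      have m: "m \<in> polys_over F"
        unfolding m_def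
        by (intro polys_over_monom is_subfieldD(8)[OF F] polys_overD[OF less.prems] polys_overD[OF f(1)])
      have deg: "degree (m * f) = degree p"
      proof -
        have "lead_coeff p / lead_coeff f \<noteq> 0" using False f by simp
        hence "degree m = degree p - degree f" "m \<noteq> 0"
          unfolding m_def by (simp_all only: degree_monom_eq monom_eq_0_iff not_False_eq_True)
        thus ?thesis using False f by (simp add: degree_mult_eq)
      qed
      have "lead_coeff (m * f) = lead_coeff p"
        using f unfolding lead_coeff_mult m_def lead_coeff_monom by simp
      hence "coeff (p - m * f) (degree p) = 0"
        by (simp add: deg)
      moreover have "degree (p - m * f) \<le> degree p"
        by (rule degree_diff_le) (simp_all add: deg)
      ultimately have dec: "p - m * f = 0 \<or> degree (p - m * f) < degree p"
        using eq_zero_or_degree_less by blast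
      have pm: "p - m * f \<in> polys_over F"
        using less.prems m f by (intro polys_over_diff polys_over_mult)
      have "\<exists>q r. q \<in> polys_over F \<and> r \<in> polys_over F \<and> p - m * f = q * f + r \<and>
              (r = 0 \<or> degree r < degree f)"
      proof (cases "p - m * f = 0")
        case True
        thus ?thesis by (intro exI[of _ 0]) (auto intro: polys_over_0)
      next
        case False
        thus ?thesis using less.hyps[of "p - m * f"] pm dec by blast
      qed
      then obtain q r where "q \<in> polys_over F" "r \<in> polys_over F" "p - m * f = q * f + r"
          "r = 0 \<or> degree r < degree f"
        by blast
      thus ?thesis
        using m by (intro exI[of _ "q + m"] exI[of _ r]) (auto intro: polys_over_add simp: algebra_simps)
    qed
  qed
  thus ?thesis using that by blast
qed

end

lemma polys_over_mono: "F \<subseteq> E \<Longrightarrow> polys_over F \<subseteq> polys_over E"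
  by (auto simp: polys_over_def)

definition fractions_over :: "'a::field set \<Rightarrow> 'a poly fract set" where
  "fractions_over F = {to_fract p / to_fract s | p s. p \<in> polys_over F \<and> s \<in> polys_over F \<and> s \<noteq> 0}"

lemma common_denominator:
  assumes F: "is_subfield F" and "finite I" "\<And>i. i \<in> I \<Longrightarrow> c i \<in> fractions_over F"
  obtains s p where "s \<in> polys_over F" "s \<noteq> 0" "\<And>i. i \<in> I \<Longrightarrow> p i \<in> polys_over F"
    "\<And>i. i \<in> I \<Longrightarrow> to_fract s * c i = to_fract (p i)"
proof -
  have "\<exists>s p. s \<in> polys_over F \<and> s \<noteq> 0 \<and> (\<forall>i\<in>I. p i \<in> polys_over F \<and> to_fract s * c i = to_fract (p i))"
    using assms(2,3)
  proof (induction I)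
    case empty
    show ?case using polys_over_1[OF F] by (intro exI[of _ 1]) auto
  next
    case (insert x I)
    then obtain s p where s: "s \<in> polys_over F" "s \<noteq> 0"
      "\<And>i. i \<in> I \<Longrightarrow> p i \<in> polys_over F \<and> to_fract s * c i = to_fract (p i)" by blast
    obtain p' s' where s': "p' \<in> polys_over F" "s' \<in> polys_over F" "s' \<noteq> 0"
        "c x = to_fract p' / to_fract s'"
      using insert.prems[of x] by (auto simp: fractions_over_def)
    have "to_fract (s * s') * c i = to_fract (if i = x then s * p' else s' * p i)" if "i \<in> insert x I" for i
    proof (cases "i = x")
      case False
      hence "to_fract s * c i = to_fract (p i)" using s(3) that by blast
      thus ?thesis using False by (simp add: mult_ac)
    qed (use s' in simp)
    thus ?case
      using s s' insert.hyps
      by (intro exI[of _ "s * s'"] exI[of _ "\<lambda>i. if i = x then s * p' else s' * p i"])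
        (auto intro: polys_over_mult[OF F])
  qed
  thus ?thesis using that by blast
qed

section \<open>The powers of \<open>X - a\<close> as a valuation basis\<close>

text \<open>
  Here \<open>f\<close> stands for the minimal polynomial of \<open>a\<close> over \<open>K\<close> and \<open>L\<close> for \<open>K(a)\<close>.  The
  assumption \<open>minimal\<close> is the second condition on a minimal pair: a root of \<open>q\<close> near \<open>a\<close> would have
  smaller degree over \<open>K\<close> than \<open>a\<close>.
\<close>

locale minimal_centre = maximal_centre v a
  for v :: "'a::alg_closed_field poly fract \<Rightarrow> 'g::linordered_ab_group_add extended" and a :: 'a +
  fixes K L :: "'a set" and f :: "'a poly"
  assumes subfield_K: "is_subfield K"
    and subfield_L: "is_subfield L"
    and L_eq: "L = (\<lambda>q. poly q a) ` polys_over K"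
    and f_over_K: "f \<in> polys_over K"
    and f_nonzero: "f \<noteq> 0"
    and f_root: "poly f a = 0"
    and minimal: "\<lbrakk>q \<in> polys_over K; q \<noteq> 0; degree q < degree f\<rbrakk> \<Longrightarrow> initial_degree q = 0"
begin

abbreviation j :: nat where
  "j \<equiv> initial_degree f"

lemma degree_f_pos: "0 < degree f"
  using f_nonzero f_root by (metis degree_eq_zeroE gr0I pCons_0_0 poly_const_conv)

lemma j_pos: "0 < j"
proof -
  obtain g where g: "f = [:- a, 1:] * g"
    using f_root by (metis dvdE poly_eq_0_iff_dvd)
  hence "j = initial_degree [:- a, 1:] + initial_degree g"
    using f_nonzero initial_degree_mult[of "[:- a, 1:]" g] by (auto simp del: mult_pCons_left)
  thus ?thesis
    by (simp add: initial_degree_linear)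
qed

lemma K_subset_L: "K \<subseteq> L"
  unfolding L_eq by (rule subsetI, rule_tac x = "[:x:]" in image_eqI)
    (simp_all add: polys_over_const[OF subfield_K])

lemma a_in_L: "a \<in> L"
  unfolding L_eq using is_subfieldD(1,2)[OF subfield_K]
  by (intro image_eqI[of _ _ "[:0, 1:]"])
    (simp_all add: polys_over_pCons[OF subfield_K] polys_over_const[OF subfield_K])

text \<open>
  In the expansion of \<open>c\<close> in powers of \<open>f\<close> the coefficients have initial degree \<open>0\<close>, so the terms have
  the distinct initial degrees \<open>k * j\<close>, and \<open>c\<close> inherits one of them.
\<close>

lemma dvd_initial_degree:
  assumes "c \<in> polys_over K" "c \<noteq> 0"
  shows "j dvd initial_degree c"
  using assms
proof (induction "degree c" arbitrary: c rule: less_induct)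
  case less
  obtain q r where qr: "q \<in> polys_over K" "r \<in> polys_over K" "c = q * f + r"
      "r = 0 \<or> degree r < degree f"
    using polys_over_div_mod[OF subfield_K f_over_K f_nonzero less.prems(1)] by blast
  show ?case
  proof (cases "q = 0")
    case True
    thus ?thesis using qr less.prems(2) minimal[of r] by auto
  next
    case False
    have deg: "degree (q * f) = degree q + degree f"
      using False f_nonzero by (rule degree_mult_eq)
    have "degree c = degree q + degree f"
      using qr(3,4) deg degree_add_eq_left[of r "q * f"] by auto
    hence "j dvd initial_degree q"
      using less.hyps[of q] qr(1) False degree_f_pos by simp
    hence dvd: "j dvd initial_degree (q * f)"
      by (simp add: initial_degree_mult[OF False f_nonzero])
    show ?thesis
    proof (cases "r = 0")
      case True
      thus ?thesis using qr(3) dvd by simp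
    next
      case r: False
      have r0: "initial_degree r = 0"
        using qr r minimal by blast
      have "initial_degree (q * f) \<noteq> initial_degree r"
        using j_pos by (simp add: r0 initial_degree_mult[OF False f_nonzero])
      hence "initial_degree c \<in> {initial_degree (q * f), initial_degree r}"
        using initial_degree_add(3)[of "q * f" r] False f_nonzero r qr(3) by simp
      thus ?thesis using dvd r0 by auto
    qed
  qed
qed

text \<open>
  After clearing denominators the \<open>i\<close>-th term has initial degree congruent to \<open>i\<close> modulo \<open>j\<close>, so no
  two terms have the same initial degree.
\<close>

lemma powers_independent:
  assumes c: "\<And>i. i < j \<Longrightarrow> c i \<in> fractions_over K" and i: "i < j"
  shows "v (\<Sum>i<j. c i * T ^ i) \<le> v (c i * T ^ i)"
proof (cases "c i = 0")
  case False
  obtain s p where sp: "s \<noteq> 0" "\<And>i. i < j \<Longrightarrow> p i \<in> polys_over K"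
      "\<And>i. i < j \<Longrightarrow> to_fract s * c i = to_fract (p i)"
    using common_denominator[OF subfield_K, of "{..<j}" c] c by (metis finite_lessThan lessThan_iff)
  define P where "P = (\<lambda>i. p i * [:- a, 1:] ^ i)"
  have P: "to_fract s * (c i * T ^ i) = to_fract (P i)" if "i < j" for i
    using sp(3)[OF that] unfolding P_def to_fract_mult to_fract_power indet_minus_const[symmetric]
    by (simp add: mult.assoc[symmetric])
  define S where "S = {i. i < j \<and> P i \<noteq> 0}"
  have mod: "initial_degree (P i) mod j = i" if "i \<in> S" for i
  proof -
    have i: "i < j" "p i \<noteq> 0" using that by (auto simp: S_def P_def)
    have "initial_degree (P i) = initial_degree (p i) + i"
      unfolding P_def using i by (simp add: initial_degree_mult initial_degree_power initial_degree_linear)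
    thus ?thesis
      using dvd_initial_degree[OF sp(2)[OF i(1)] i(2)] i(1) by (auto elim!: dvdE)
  qed
  have "to_fract s * (\<Sum>i<j. c i * T ^ i) = to_fract (\<Sum>i<j. P i)"
    using P by (simp add: sum_distrib_left)
  also have "(\<Sum>i<j. P i) = (\<Sum>i\<in>S. P i)"
    by (intro sum.mono_neutral_right) (auto simp: S_def)
  finally have sum: "to_fract s * (\<Sum>i<j. c i * T ^ i) = to_fract (\<Sum>i\<in>S. P i)" .
  have "P i \<noteq> 0"
    using P[OF i] False sp(1) T_nonzero by (metis mult_eq_0_iff power_not_zero to_fract_eq_0_iff)
  hence "w (\<Sum>i\<in>S. P i) \<le> w (P i)"
    using i mod by (intro w_sum_le) (auto simp: S_def, metis)
  hence "v (to_fract s * (\<Sum>i<j. c i * T ^ i)) \<le> v (to_fract s * (c i * T ^ i))"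
    by (simp only: sum P[OF i])
  thus ?thesis
    using v_mult_le_cancel sp(1) by simp
qed simp

text \<open>
  Up to an error of larger value, every element of \<open>K(a)\<close> lies in \<open>K[X]\<close>: write it as a polynomial
  of degree less than \<open>degree f\<close> in \<open>a\<close>, and replace \<open>a\<close> by \<open>X\<close>.
\<close>

lemma approximate_L:
  assumes "d \<in> L" "d \<noteq> 0"
  obtains s where "s \<in> polys_over K" "s \<noteq> 0" "initial_degree s = 0"
    "v (const d) < v (to_fract s - const d)"
proof -
  obtain p where p: "p \<in> polys_over K" "d = poly p a"
    using assms(1) L_eq by blast
  obtain q s where s: "q \<in> polys_over K" "s \<in> polys_over K" "p = q * f + s" "s = 0 \<or> degree s < degree f"
    using polys_over_div_mod[OF subfield_K f_over_K f_nonzero p(1)] by blast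
  have d: "d = poly s a" using p(2) s(3) f_root by simp
  hence s0: "s \<noteq> 0" using assms(2) by auto
  have init: "initial_degree s = 0" using minimal s s0 by blast
  have less: "w s < v (to_fract s - const d)"
    using close_to_value[OF s0 init] d by simp
  hence "v (const d) = w s" by (rule v_close_eq)
  thus ?thesis using that s s0 init less by simp
qed

lemma taylor_term_ge: "w p \<le> v (taylor_term a p m)"
  using taylor_term_bounds(1)[of p m] by (cases "p = 0") (simp_all add: taylor_term_def)

text \<open>
  Division with remainder of leading parts.  If \<open>y\<close> has initial degree \<open>m\<close>, then
  \<open>f ^ (m div j) * T ^ (m mod j)\<close> has the same initial degree, and a multiple of it by
  some element of \<open>K(a)\<close> has the same \<open>m\<close>-th Taylor term as \<open>y\<close>.  That element may be replaced by a
  polynomial over \<open>K\<close>.  Subtraction leaves a polynomial of larger value or of smaller initial degree.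
\<close>

lemma approximate_polys:
  assumes "y \<in> polys_over L" "y \<noteq> 0"
  shows "\<exists>c. (\<forall>i<j. c i \<in> polys_over K) \<and> w y < v (to_fract y - (\<Sum>i<j. to_fract (c i) * T ^ i))"
  using assms
proof (induction "initial_degree y" arbitrary: y rule: less_induct)
  case less
  define m where "m = initial_degree y"
  define r where "r = m mod j"
  define u where "u = f ^ (m div j) * [:- a, 1:] ^ r"
  have r: "r < j" using j_pos by (simp add: r_def)
  have u0: "u \<noteq> 0" using f_nonzero by (simp add: u_def)
  have init_u: "initial_degree u = m"
    using f_nonzero
    by (simp add: u_def initial_degree_mult initial_degree_power initial_degree_linear r_def)
  have lin: "[:- a, 1:] \<in> polys_over L" "[:a, 1:] \<in> polys_over L"
    using a_in_L is_subfieldD(2,5)[OF subfield_L]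
    by (auto intro!: polys_over_pCons[OF subfield_L] polys_over_0[OF subfield_L])
  have u: "u \<in> polys_over L"
    unfolding u_def using f_over_K polys_over_mono[OF K_subset_L] lin
    by (intro polys_over_mult[OF subfield_L] polys_over_power[OF subfield_L]) auto
  let ?cy = "coeff (y \<circ>\<^sub>p [:a, 1:]) m" and ?cu = "coeff (u \<circ>\<^sub>p [:a, 1:]) m"
  have nonzero: "?cy \<noteq> 0" "?cu \<noteq> 0"
  proof -
    have "taylor_term a p (initial_degree p) \<noteq> 0" if "p \<noteq> 0" for p
      using taylor_term_bounds(3)[OF that] that by (metis to_fract_eq_0_iff v_eq_Pinf)
    from this[OF less.prems(2)] this[OF u0] show "?cy \<noteq> 0" "?cu \<noteq> 0"
      by (auto simp: taylor_term_def m_def[symmetric] init_u)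
  qed
  define d where "d = ?cy / ?cu"
  have "d \<in> L" "d \<noteq> 0"
    unfolding d_def using nonzero polys_overD[OF polys_over_pcompose[OF subfield_L _ lin(2)]] u less.prems(1)
    by (auto intro: is_subfieldD(8)[OF subfield_L])
  then obtain s where s: "s \<in> polys_over K" "s \<noteq> 0" "initial_degree s = 0"
      "v (const d) < v (to_fract s - const d)"
    using approximate_L by blast
  have term_m: "const d * taylor_term a u m = taylor_term a y m"
    using nonzero by (simp add: taylor_term_def mult.assoc[symmetric] d_def flip: const_simps(6))
  have wy: "w y = v (const d * to_fract u)"
    using term_m taylor_term_bounds(3)[OF less.prems(2)] taylor_term_bounds(3)[OF u0]
    by (simp add: m_def[symmetric] init_u v_mult) (metis v_mult)
  define y' where "y' = y - s * u"
  have y': "y' \<in> polys_over L"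
    unfolding y'_def using less.prems(1) u s(1) polys_over_mono[OF K_subset_L]
    by (intro polys_over_diff[OF subfield_L] polys_over_mult[OF subfield_L]) auto
  \<comment> \<open>The error made when \<open>d\<close> is replaced by its approximation \<open>s\<close>.\<close>
  define e where "e = (s - [:d:]) * u"
  have "w y < w e"
  proof -
    have "v (to_fract u * const d) < v (to_fract u * (to_fract s - const d))"
      using s(4) u0 by (subst v_mult_less_cancel) auto
    also have "to_fract u * (to_fract s - const d) = to_fract e"
      by (simp add: e_def)
    finally show ?thesis
      unfolding wy by (simp add: mult.commute)
  qed
  hence e: "w y < v (taylor_term a e k)" for k
    using taylor_term_ge[of e k] by (rule less_le_trans)
  have y'_eq: "y' = (y - smult d u) - e"
    by (simp add: y'_def e_def algebra_simps)
  have terms: "taylor_term a y' k = taylor_term a y k - const d * taylor_term a u k - taylor_term a e k" for k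
    unfolding y'_eq taylor_term_diff taylor_term_smult ..
  have above: "w y < v (taylor_term a y' k)" if "m \<le> k" for k
  proof (cases "k = m")
    case True
    thus ?thesis unfolding terms using term_m e by simp
  next
    case False
    have "w y < v (const d * taylor_term a u k)"
      unfolding wy using False that taylor_term_bounds(2)[OF u0, of k] \<open>d \<noteq> 0\<close>
      by (intro v_mult_strict_mono) (auto simp: init_u)
    thus ?thesis
      unfolding terms using False that taylor_term_bounds(2)[OF less.prems(2), of k] e
      by (intro v_diff_gt) (auto simp: m_def)
  qed
  have "w y \<le> v (taylor_term a y' k)" for k
    unfolding terms using taylor_term_ge[of y k] less_imp_le[OF e[of k]]
      v_mult_mono[OF order_refl taylor_term_ge[of u k], of "const d"] wy
    by (intro v_diff_ge) auto
  hence ge: "w y \<le> w y'"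
    unfolding taylor_expansion[of y' a] by (intro v_sum_ge)
  have "\<exists>c. (\<forall>i<j. c i \<in> polys_over K) \<and> w y < v (to_fract y' - (\<Sum>i<j. to_fract (c i) * T ^ i))"
  proof (cases "w y < w y'")
    case True
    thus ?thesis using polys_over_0[OF subfield_K] by (intro exI[of _ "\<lambda>_. 0"]) simp
  next
    case False
    hence eq: "w y' = w y" using ge by simp
    hence y'0: "y' \<noteq> 0" using less.prems(2) by (metis to_fract_eq_0_iff v_eq_Pinf)
    have "initial_degree y' < initial_degree y"
      using above[of "initial_degree y'"] taylor_term_bounds(3)[OF y'0] eq
      by (auto simp: m_def not_less[symmetric])
    thus ?thesis using less.hyps[OF _ y' y'0] eq by simp
  qed
  then obtain c where c: "\<forall>i<j. c i \<in> polys_over K"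
    "w y < v (to_fract y' - (\<Sum>i<j. to_fract (c i) * T ^ i))" by blast
  define c' where "c' = (\<lambda>i. c i + (if i = r then s * f ^ (m div j) else 0))"
  have "(\<Sum>i<j. to_fract (c' i) * T ^ i) =
      (\<Sum>i<j. to_fract (c i) * T ^ i) + (\<Sum>i<j. if i = r then to_fract (s * f ^ (m div j)) * T ^ i else 0)"
    unfolding sum.distrib[symmetric] by (intro sum.cong) (auto simp: c'_def algebra_simps)
  also have "(\<Sum>i<j. if i = r then to_fract (s * f ^ (m div j)) * T ^ i else 0) = to_fract (s * u)"
    using r by (simp add: u_def to_fract_power indet_minus_const mult.assoc)
  finally have "to_fract y - (\<Sum>i<j. to_fract (c' i) * T ^ i) =
      to_fract y' - (\<Sum>i<j. to_fract (c i) * T ^ i)"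
    by (simp add: y'_def algebra_simps)
  moreover have "\<forall>i<j. c' i \<in> polys_over K"
    unfolding c'_def using c(1) s(1) f_over_K polys_over_0[OF subfield_K]
    by (auto intro!: polys_over_add[OF subfield_K] polys_over_mult[OF subfield_K] polys_over_power[OF subfield_K])
  ultimately show ?case using c(2) by (intro exI[of _ c']) simp
qed

lemma approximate_fractions:
  assumes "p \<in> polys_over L" "s \<in> polys_over K" "p \<noteq> 0" "s \<noteq> 0"
  defines "y \<equiv> to_fract p / to_fract s"
  shows "\<exists>c. (\<forall>i<j. c i \<in> fractions_over K) \<and> v y < v (y - (\<Sum>i<j. c i * T ^ i))"
proof -
  obtain c where c: "\<forall>i<j. c i \<in> polys_over K" "w p < v (to_fract p - (\<Sum>i<j. to_fract (c i) * T ^ i))"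
    using approximate_polys[OF assms(1,3)] by blast
  have "(\<Sum>i<j. to_fract (c i) / to_fract s * T ^ i) = (\<Sum>i<j. to_fract (c i) * T ^ i) / to_fract s"
    by (simp add: sum_divide_distrib)
  hence "to_fract s * (y - (\<Sum>i<j. to_fract (c i) / to_fract s * T ^ i)) =
      to_fract p - (\<Sum>i<j. to_fract (c i) * T ^ i)"
    using assms(4) by (simp add: y_def algebra_simps)
  moreover have "to_fract s * y = to_fract p"
    using assms(4) by (simp add: y_def)
  ultimately have "v (to_fract s * y) < v (to_fract s * (y - (\<Sum>i<j. to_fract (c i) / to_fract s * T ^ i)))"
    using c(2) by simp
  hence "v y < v (y - (\<Sum>i<j. to_fract (c i) / to_fract s * T ^ i))"
    using assms(4) by (subst (asm) v_mult_less_cancel) auto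
  moreover have "\<forall>i<j. to_fract (c i) / to_fract s \<in> fractions_over K"
    using c(1) assms(2,4) by (auto simp: fractions_over_def)
  ultimately show ?thesis
    by (intro exI[of _ "\<lambda>i. to_fract (c i) / to_fract s"]) simp
qed

lemma index_times_degree:
  assumes "is_subfield (fractions_over K)" "is_subfield E" "fractions_over K \<subseteq> E" "T \<in> E"
    and E: "\<And>y. y \<in> E \<Longrightarrow>
      \<exists>p\<in>polys_over L. \<exists>s\<in>polys_over K. s \<noteq> 0 \<and> y = to_fract p / to_fract s"
  shows "group_index (value_group v E) (carrier (value_group v (fractions_over K))) *
    ext_degree (residue_field v) (residue_subfield v (fractions_over K)) (residue_subfield v E) = j"
proof -
  interpret valuation_basis v "fractions_over K" E "{..<j}" "\<lambda>i. T ^ i"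
  proof (intro valuation_basis.intro valuation_basis_axioms.intro valued_field_axioms)
    fix y assume y: "y \<in> E" "y \<noteq> 0"
    then obtain p s where "p \<in> polys_over L" "s \<in> polys_over K" "s \<noteq> 0" "y = to_fract p / to_fract s"
      using E by blast
    thus "\<exists>c. (\<forall>i\<in>{..<j}. c i \<in> fractions_over K) \<and> v y < v (y - (\<Sum>i<j. c i * T ^ i))"
      using approximate_fractions[of p s] y(2) by (auto simp: lessThan_def)
  next
    fix c i assume "\<And>i. i \<in> {..<j} \<Longrightarrow> c i \<in> fractions_over K" "i \<in> {..<j}"
    thus "v (\<Sum>i<j. c i * T ^ i) \<le> v (c i * T ^ i)"
      using powers_independent[of c i] by simp
  qed (use assms T_nonzero in \<open>auto intro: is_subfield_power\<close>)
  show ?thesis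
    using index_times_degree by simp
qed

end

section \<open>Polynomials as lists of coefficients\<close>

text \<open>
  Translation to the representation of polynomials by lists of coefficients with the leading
  coefficient first, in which minimal polynomials and multisets of roots are given.
\<close>

definition to_list :: "'a::zero poly \<Rightarrow> 'a list" where
  "to_list p = rev (coeffs p)"

lemma to_list_simps [simp]: "Poly (rev (to_list p)) = p" "to_list p = [] \<longleftrightarrow> p = 0"
    "length (to_list p) - Suc 0 = degree p"
  by (simp_all add: to_list_def degree_eq_length_coeffs)

lemma to_list_in_carrier:
  fixes F :: "'f::field set"
  assumes "p \<in> polys_over F"
  shows "to_list p \<in> carrier (F[X]\<^bsub>ring_of_type_algebra\<^esub>)"
proof (cases "p = 0")
  case False
  have "set (coeffs p) \<subseteq> F"
  proof
    fix x assume "x \<in> set (coeffs p)"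
    hence "x \<in> range (coeff p)" by (simp add: range_coeff)
    thus "x \<in> F" using polys_overD[OF assms] by blast
  qed
  moreover have "hd (to_list p) \<noteq> 0"
    using False by (simp add: to_list_def hd_rev last_coeffs_eq_coeff_degree)
  ultimately show ?thesis
    by (simp add: univ_poly_carrier[symmetric] polynomial_def to_list_def)
qed (simp add: to_list_def univ_poly_carrier[symmetric] polynomial_def)

lemma to_list_exhaust:
  fixes F :: "'f::field set"
  assumes F: "is_subfield F" and l: "l \<in> carrier (F[X]\<^bsub>ring_of_type_algebra\<^esub>)"
  obtains p where "p \<in> polys_over F" "l = to_list p"
proof (cases "l = []")
  case True
  thus ?thesis using that[of 0] polys_over_0[OF F] by (simp add: to_list_def)
next
  case False
  hence l': "set l \<subseteq> F" "hd l \<noteq> 0"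
    using l by (auto simp: univ_poly_carrier[symmetric] polynomial_def)
  have "Poly (rev l) \<in> polys_over F"
    using l'(1) is_subfieldD(1)[OF F] nth_mem[of _ "rev l"]
    by (auto simp: polys_over_def coeff_Poly_eq nth_default_def)
  moreover have "coeffs (Poly (rev l)) = rev l"
    using l' False by (cases l) (auto simp: strip_while_def)
  ultimately show ?thesis using that[of "Poly (rev l)"] by (simp add: to_list_def)
qed

lemma type_ring_pow: "(x::'f::field) [^]\<^bsub>ring_of_type_algebra\<^esub> (n::nat) = x ^ n"
proof -
  interpret R: field "ring_of_type_algebra :: 'f ring" by (rule field_from_type_algebra)
  show ?thesis by (induction n) simp_all
qed

lemma eval_type_ring:
  fixes x :: "'f::field"
  shows "ring.eval ring_of_type_algebra l x = poly (Poly (rev l)) x"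
proof -
  interpret R: field "ring_of_type_algebra :: 'f ring" by (rule field_from_type_algebra)
  show ?thesis
    by (induction l) (simp_all add: Poly_append poly_monom type_ring_pow mult.commute)
qed

lemma coeff_type_ring:
  "ring.coeff ring_of_type_algebra l i = coeff (Poly (rev l) :: 'f::field poly) i"
proof -
  interpret R: field "ring_of_type_algebra :: 'f ring" by (rule field_from_type_algebra)
  show ?thesis
    by (induction l arbitrary: i) (auto simp: coeff_Poly_eq nth_default_def nth_append)
qed

lemma finsum_type_ring:
  fixes g :: "'i \<Rightarrow> 'f::field"
  assumes "finite A"
  shows "(\<Oplus>\<^bsub>ring_of_type_algebra\<^esub>i\<in>A. g i) = (\<Sum>i\<in>A. g i)"
proof -
  interpret R: field "ring_of_type_algebra :: 'f ring" by (rule field_from_type_algebra)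
  show ?thesis
    using assms by (induction A) (simp_all add: R.finsum_insert)
qed

lemma to_list_mult:
  fixes p q :: "'f::field poly"
  shows "to_list (p * q) = to_list p \<otimes>\<^bsub>poly_ring ring_of_type_algebra\<^esub> to_list q"
proof -
  interpret R: field "ring_of_type_algebra :: 'f ring" by (rule field_from_type_algebra)
  have carrier: "polynomial\<^bsub>ring_of_type_algebra\<^esub> UNIV (to_list (r :: 'f poly))" for r
    using to_list_in_carrier[of r UNIV] by (simp add: univ_poly_carrier[symmetric] polys_over_def)
  show ?thesis
    unfolding univ_poly_mult
    using R.coeff_iff_polynomial_cond[OF carrier R.poly_mult_closed[OF R.carrier_is_subring, simplified, OF carrier carrier]]
      R.poly_mult_coeff[of "to_list p" "to_list q"]
    by (simp add: fun_eq_iff coeff_type_ring finsum_type_ring coeff_mult)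
qed

text \<open>
  Both multisets gain the same element when a linear factor is split off.
\<close>

lemma roots_to_list:
  fixes p :: "'f::alg_closed_field poly"
  assumes "p \<noteq> 0"
  shows "ring.roots ring_of_type_algebra (to_list p) = proots p"
proof -
  interpret R: field "ring_of_type_algebra :: 'f ring" by (rule field_from_type_algebra)
  have carrier: "to_list r \<in> carrier (poly_ring (ring_of_type_algebra :: 'f ring))" for r
    using to_list_in_carrier[of r UNIV] by (simp add: polys_over_def)
  show ?thesis
    using assms
  proof (induction "degree p" arbitrary: p)
    case 0
    then obtain c where "p = [:c:]" by (metis degree_eq_zeroE)
    thus ?case
      using R.degree_zero_imp_empty_roots[OF carrier[of p]] 0 by (simp add: to_list_def)
  next
    case (Suc n p)
    obtain b where "poly p b = 0"
      using alg_closed_imp_poly_has_root[of p] Suc.hyps(2) by auto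
    then obtain q where q: "p = [:- b, 1:] * q"
      using poly_eq_0_iff_dvd by (metis dvdE)
    have q0: "q \<noteq> 0" using q Suc.prems by auto
    have "n = degree q"
      using Suc.hyps(2) q q0 by (simp add: degree_mult_eq del: mult_pCons_left)
    hence IH: "R.roots (to_list q) = proots q"
      using Suc.hyps(1) q0 by blast
    have "R.roots (to_list p) = add_mset b (R.roots (to_list q))"
      using R.poly_mult_degree_one_monic_imp_same_roots[of b "to_list q", OF _ carrier] q0
      unfolding q to_list_mult by (simp add: to_list_def)
    also have "\<dots> = proots p"
      unfolding q IH using q0 proots_mult[of "[:- b, 1:]" q] by (simp del: mult_pCons_left)
    finally show ?case .
  qed
qed

section \<open>Fields generated by algebraic elements and by the indeterminate\<close>

lemma ratfun_subfield: "is_subfield (ratfun H)"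
proof -
  interpret R: field "ring_of_type_algebra :: 'a poly fract ring" by (rule field_from_type_algebra)
  show ?thesis
    unfolding ratfun_def by (rule R.generate_field_is_subfield) simp
qed

lemma ratfun_generators: "indet \<in> ratfun H" "c \<in> H \<Longrightarrow> const c \<in> ratfun H"
  unfolding ratfun_def by (auto intro: generate_field.incl)

lemma ratfun_minimal:
  fixes E :: "'a::field poly fract set"
  assumes "is_subfield E" "indet \<in> E" "\<And>c. c \<in> H \<Longrightarrow> const c \<in> E"
  shows "ratfun H \<subseteq> E"
proof -
  interpret R: field "ring_of_type_algebra :: 'a poly fract ring" by (rule field_from_type_algebra)
  show ?thesis
    unfolding ratfun_def by (rule R.generate_field_min_subfield1) (use assms in auto)
qed

lemma polys_in_ratfun:
  assumes "p \<in> polys_over H"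
  shows "to_fract p \<in> ratfun H"
  using assms
proof (induction p)
  case 0
  show ?case using is_subfieldD(1)[OF ratfun_subfield] by simp
next
  case (pCons c p)
  have "c \<in> H" "p \<in> polys_over H"
    using polys_overD[OF pCons.prems, of 0] polys_overD[OF pCons.prems, of "Suc _"]
    by (simp_all add: polys_over_def)
  moreover have "to_fract (pCons c p) = const c + indet * to_fract p"
    by (simp flip: to_fract_add to_fract_mult)
  ultimately show ?case
    using pCons.IH ratfun_generators is_subfieldD(3,4)[OF ratfun_subfield] by metis
qed

lemma ratfun_eq_fractions:
  assumes K: "is_subfield K"
  shows "ratfun K = fractions_over K"
proof
  show "fractions_over K \<subseteq> ratfun K"
    by (auto simp: fractions_over_def intro!: is_subfieldD(8)[OF ratfun_subfield] polys_in_ratfun)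
  have I: "to_fract p / to_fract s \<in> fractions_over K"
    if "p \<in> polys_over K" "s \<in> polys_over K" "s \<noteq> 0" for p s
    using that by (auto simp: fractions_over_def)
  have poly: "to_fract p \<in> fractions_over K" if "p \<in> polys_over K" for p
    using I[OF that polys_over_1[OF K]] by simp
  show "ratfun K \<subseteq> fractions_over K"
  proof (rule ratfun_minimal)
    show "is_subfield (fractions_over K)"
    proof (rule is_subfieldI)
      show "1 \<in> fractions_over K" using poly[OF polys_over_1[OF K]] by simp
    next
      fix x y assume "x \<in> fractions_over K" "y \<in> fractions_over K"
      then obtain p s q t where *: "p \<in> polys_over K" "s \<in> polys_over K" "s \<noteq> 0"
          "q \<in> polys_over K" "t \<in> polys_over K" "t \<noteq> 0"
          "x = to_fract p / to_fract s" "y = to_fract q / to_fract t"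
        by (auto simp: fractions_over_def)
      have eq: "x + y = to_fract (p * t + q * s) / to_fract (s * t)"
           "x * y = to_fract (p * q) / to_fract (s * t)"
        using * by (simp_all add: add_frac_eq)
      show "x + y \<in> fractions_over K" "x * y \<in> fractions_over K"
        unfolding eq
        by (intro I polys_over_add[OF K] polys_over_mult[OF K]; use * in simp)+
    next
      fix x assume "x \<in> fractions_over K"
      then obtain p s where *: "p \<in> polys_over K" "s \<in> polys_over K" "s \<noteq> 0" "x = to_fract p / to_fract s"
        by (auto simp: fractions_over_def)
      thus "- x \<in> fractions_over K"
        using I[of "- p" s] by (simp add: polys_over_minus[OF K])
      show "inverse x \<in> fractions_over K" if "x \<noteq> 0"
        using that * I[of s p] by auto
    qed
    show "indet \<in> fractions_over K"
      using is_subfieldD(1,2)[OF K] by (intro poly polys_over_pCons[OF K] polys_over_0[OF K])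
    show "const c \<in> fractions_over K" if "c \<in> K" for c
      using that by (intro poly) (simp add: polys_over_const[OF K])
  qed
qed

lemma simple_extension_eq:
  fixes K :: "'a::field set"
  assumes K: "is_subfield K"
  shows "ring.simple_extension ring_of_type_algebra K b = (\<lambda>q. poly q b) ` polys_over K"
proof -
  interpret R: field "ring_of_type_algebra :: 'a ring" by (rule field_from_type_algebra)
  have "R.simple_extension K b = (\<lambda>q. R.eval q b) ` carrier (K[X]\<^bsub>ring_of_type_algebra\<^esub>)"
    by (rule R.simple_extension_as_eval_img) simp_all
  also have "carrier (K[X]\<^bsub>ring_of_type_algebra\<^esub>) = to_list ` polys_over K"
    using to_list_in_carrier by (auto elim: to_list_exhaust[OF K])
  finally show ?thesis by (simp add: image_image eval_type_ring)
qed

context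
  fixes K :: "'a::field set" and b :: 'a and p :: "'a poly"
  assumes K: "is_subfield K" and p: "p \<in> polys_over K" "p \<noteq> 0" "poly p b = 0"
begin

lemma generate_field_algebraic:
  "generate_field ring_of_type_algebra (insert b K) = (\<lambda>q. poly q b) ` polys_over K"
  and algebraic_over: "(ring.algebraic ring_of_type_algebra over K) b"
proof -
  interpret R: field "ring_of_type_algebra :: 'a ring" by (rule field_from_type_algebra)
  show alg: "(R.algebraic over K) b"
    by (rule R.algebraicI[OF to_list_in_carrier[OF p(1)]]) (simp_all add: p eval_type_ring)
  have sub: "subfield (R.simple_extension K b) ring_of_type_algebra"
    using R.simple_extension_is_subfield[OF K] alg by simp
  have "R.simple_extension K b = generate_field ring_of_type_algebra (insert b K)"
  proof (rule R.generate_fieldI[OF _ sub])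
    show "insert b K \<subseteq> R.simple_extension K b"
      using R.simple_extension_incl[of K b] R.simple_extension_mem[OF subfieldE(1)[OF K], of b] by simp
    show "R.simple_extension K b \<subseteq> E" if "is_subfield E" "insert b K \<subseteq> E" for E
      using that by (intro R.simple_extension_subring_incl subfieldE(1)) auto
  qed simp
  thus "generate_field ring_of_type_algebra (insert b K) = (\<lambda>q. poly q b) ` polys_over K"
    using simple_extension_eq[OF K] by simp
qed

lemma minimal_polynomial:
  obtains f where "f \<in> polys_over K" "f \<noteq> 0" "poly f b = 0" "degree f = degree_over K b"
    "ring.Irr ring_of_type_algebra K b = to_list f" "degree_over K b \<le> degree p"
proof -
  interpret R: field "ring_of_type_algebra :: 'a ring" by (rule field_from_type_algebra)
  note alg = algebraic_over
  note Irr = R.IrrE[OF K _ alg, simplified]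
  obtain f where f: "f \<in> polys_over K" "R.Irr K b = to_list f"
    using to_list_exhaust[OF K Irr(1)] by blast
  have sub: "generate_field ring_of_type_algebra (insert b K) = R.simple_extension K b"
    by (simp add: generate_field_algebraic simple_extension_eq[OF K])
  have deg: "degree_over K b = degree f"
    unfolding degree_over_def ext_degree_def sub
    using R.finite_dimension_simple_extension[OF K, of b] R.simple_extension_dim[OF K _ alg] alg f(2)
    by (simp add: over_def)
  have "f \<noteq> 0"
    using Irr(3) Irr(2) R.pirreducible_degree[OF K, of "to_list f"] f to_list_in_carrier[OF f(1)] by auto
  moreover have "poly f b = 0"
    using Irr(4) f(2) by (simp add: eval_type_ring)
  moreover have "degree f \<le> degree p"
  proof -
    have "to_list p \<in> carrier (K[X]\<^bsub>ring_of_type_algebra\<^esub>)" "R.eval (to_list p) b = 0"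
      using to_list_in_carrier p by (simp_all add: eval_type_ring)
    hence "to_list f pdivides\<^bsub>ring_of_type_algebra\<^esub> to_list p"
      using R.Irr_minimal[OF K _ alg] f(2) by simp
    thus ?thesis
      using R.pdivides_imp_degree_le[OF subfieldE(1)[OF K] to_list_in_carrier[OF f(1)] to_list_in_carrier[OF p(1)]] p(2)
      by simp
  qed
  ultimately show ?thesis using that f deg by simp
qed

text \<open>
  The elements of \<open>K(b,X)\<close> have denominators over \<open>K\<close>, not only over \<open>K(b)\<close>: since \<open>b\<close> is algebraic
  over \<open>K(X)\<close>, the polynomials in \<open>b\<close> with coefficients in \<open>K(X)\<close> already form a field.
\<close>

lemma ratfun_insert:
  assumes y: "y \<in> ratfun (insert b K)"
  shows "\<exists>q\<in>polys_over (generate_field ring_of_type_algebra (insert b K)). \<exists>s\<in>polys_over K.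
           s \<noteq> 0 \<and> y = to_fract q / to_fract s"
proof -
  interpret A: field "ring_of_type_algebra :: 'a ring" by (rule field_from_type_algebra)
  interpret R: field "ring_of_type_algebra :: 'a poly fract ring" by (rule field_from_type_algebra)
  let ?L = "generate_field ring_of_type_algebra (insert b K)"
  have L: "is_subfield ?L" by (rule A.generate_field_is_subfield) simp
  have L': "b \<in> ?L" "K \<subseteq> ?L" by (auto intro: generate_field.incl)
  note F = ratfun_subfield[of K]
  have "(R.algebraic over (ratfun K)) (const b)"
  proof (rule R.algebraicI[OF to_list_in_carrier])
    let ?p = "map_poly const p"
    show "?p \<in> polys_over (ratfun K)"
      using p(1) ratfun_generators(2) by (auto simp: polys_over_def coeff_map_poly)
    show "to_list ?p \<noteq> []"
      using p(2) by (simp add: map_poly_eq_0_iff)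
    have "poly ?p (const b) = const (poly p b)"
      by (induction p) (simp_all add: map_poly_pCons const_simps)
    thus "R.eval (to_list ?p) (const b) = \<zero>\<^bsub>ring_of_type_algebra\<^esub>"
      using p(3) by (simp add: eval_type_ring)
  qed
  hence "is_subfield (R.simple_extension (ratfun K) (const b))"
    using R.simple_extension_is_subfield[OF F, of "const b"] by simp
  moreover have "ratfun K \<subseteq> R.simple_extension (ratfun K) (const b)"
      "const b \<in> R.simple_extension (ratfun K) (const b)"
    using R.simple_extension_incl[of "ratfun K" "const b"] R.simple_extension_mem[OF subfieldE(1)[OF F], of "const b"]
    by simp_all
  ultimately have "ratfun (insert b K) \<subseteq> R.simple_extension (ratfun K) (const b)"
    using ratfun_generators[where H = K] by (intro ratfun_minimal) auto
  hence "y \<in> R.simple_extension (ratfun K) (const b)"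
    using y by blast
  thus ?thesis
  proof (induction y rule: R.simple_extension.induct)
    case zero
    show ?case
      using polys_over_0[OF L] polys_over_1[OF K] by (intro bexI[of _ 0] bexI[of _ 1]) auto
  next
    case (lin k1 k2)
    then obtain q s where qs: "q \<in> polys_over ?L" "s \<in> polys_over K" "s \<noteq> 0" "k1 = to_fract q / to_fract s"
      by blast
    obtain q' s' where qs': "q' \<in> polys_over K" "s' \<in> polys_over K" "s' \<noteq> 0" "k2 = to_fract q' / to_fract s'"
      using lin.hyps(2) unfolding ratfun_eq_fractions[OF K] by (auto simp: fractions_over_def)
    have "k1 * const b + k2 = to_fract (q * [:b:] * s' + q' * s) / to_fract (s * s')"
      unfolding qs qs' to_fract_mult to_fract_add using qs(3) qs'(3) by (simp add: field_simps)
    moreover have "q * [:b:] * s' + q' * s \<in> polys_over ?L"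
      using qs qs' L' polys_over_mono[OF L'(2)]
      by (intro polys_over_add[OF L] polys_over_mult[OF L]) (auto simp: polys_over_const[OF L])
    moreover have "s * s' \<in> polys_over K" "s * s' \<noteq> 0"
      using qs qs' by (auto intro: polys_over_mult[OF K])
    ultimately show ?case
      unfolding type_ring_simps by (intro bexI[of _ "q * [:b:] * s' + q' * s"] bexI[of _ "s * s'"] conjI)
  qed
qed

end

text \<open>
  For a minimal pair, a polynomial over \<open>K\<close> with a root near \<open>a\<close> has at least the degree of the minimal
  polynomial of \<open>a\<close>, so the powers \<open>T ^ i\<close> with \<open>i < j\<close> are a valuation basis of
  \<open>K(a,X)\<close> over \<open>K(X)\<close>, and the roots counted by \<open>j\<close> are the near conjugates of \<open>a\<close>.
\<close>

theorem theorem1p1: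
  fixes K :: "'a::alg_closed_field set"
    and v :: "'a poly fract \<Rightarrow> 'g::linordered_ab_group_add extended"
    and a :: 'a
    and \<gamma> :: 'g
  assumes "algebraic_closure (ring_of_type_algebra :: 'a ring) K"
    and "valuation v"
    and "valuation_transcendental v K"
    and "minimal_pair v K a \<gamma>"
  shows "group_index (value_group v (ratfun (insert a K))) (carrier (value_group v (ratfun K)))
         * ext_degree (residue_field v) (residue_subfield v (ratfun K))
             (residue_subfield v (ratfun (insert a K)))
         = size (near_conjugates v K a \<gamma>)"
proof -
  interpret A: algebraic_closure "ring_of_type_algebra :: 'a ring" K by (rule assms(1))
  have K: "is_subfield K" by (rule A.subfield_axioms)
  have algebraic: "\<exists>p\<in>polys_over K. p \<noteq> 0 \<and> poly p b = 0" for b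
  proof -
    have "(A.algebraic over K) b"
      using A.algebraic_extension[of b] by simp
    then obtain l where "l \<in> carrier (K[X]\<^bsub>ring_of_type_algebra\<^esub>)" "l \<noteq> []" "A.eval l b = 0"
      using A.algebraicE[OF subfieldE(1)[OF K], of b] by auto
    thus ?thesis by (auto simp: eval_type_ring elim!: to_list_exhaust[OF K])
  qed
  obtain p where p: "p \<in> polys_over K" "p \<noteq> 0" "poly p a = 0"
    using algebraic by blast
  obtain f where f: "f \<in> polys_over K" "f \<noteq> 0" "poly f a = 0" "degree f = degree_over K a"
      "A.Irr K a = to_list f"
    using minimal_polynomial[OF K p] by blast
  have centre: "v (indet - const a) = Fin \<gamma>" "\<And>c. v (indet - const c) \<le> Fin \<gamma>"
    and minimal: "\<And>b. v (const (a - b)) \<ge> Fin \<gamma> \<Longrightarrow> degree_over K b \<ge> degree_over K a"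
    using assms(4) by (auto simp: minimal_pair_def)
  interpret maximal_centre v a
    by unfold_locales (use assms(2) centre in auto)
  define L where "L = generate_field ring_of_type_algebra (insert a K)"
  interpret minimal_centre v a K L f
  proof (intro minimal_centre.intro minimal_centre_axioms.intro maximal_centre_axioms)
    show "is_subfield L"
      unfolding L_def by (rule A.generate_field_is_subfield) simp
    show "L = (\<lambda>q. poly q a) ` polys_over K"
      unfolding L_def by (rule generate_field_algebraic[OF K p])
    show "initial_degree q = 0" if q: "q \<in> polys_over K" "q \<noteq> 0" "degree q < degree f" for q
    proof -
      have "\<not> near b" if "b \<in># proots q" for b
      proof
        assume "near b"
        hence "degree f \<le> degree_over K b"
          using minimal[of b] f(4) by (simp add: centre(1))
        moreover have "poly q b = 0"
          using that q(2) by simp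
        hence "degree_over K b \<le> degree q"
          using minimal_polynomial[OF K q(1,2)] by blast
        ultimately show False using q(3) by simp
      qed
      hence "set_mset (filter_mset near (proots q)) = {}"
        unfolding set_mset_filter by blast
      hence "filter_mset near (proots q) = {#}"
        by (simp only: set_mset_eq_empty_iff)
      thus ?thesis
        by (simp add: initial_degree_def)
    qed
  qed (use K f in auto)
  have "near_conjugates v K a \<gamma> = filter_mset near (proots f)"
    by (simp add: near_conjugates_def f(5) roots_to_list[OF f(2)] centre(1))
  hence "size (near_conjugates v K a \<gamma>) = j"
    by (simp add: initial_degree_def)
  moreover have "ratfun K \<subseteq> ratfun (insert a K)"
    by (intro ratfun_minimal ratfun_subfield) (auto intro: ratfun_generators)
  moreover have "T \<in> ratfun (insert a K)"
    by (intro is_subfieldD(6)[OF ratfun_subfield] ratfun_generators) simp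
  ultimately show ?thesis
    using index_times_degree[of "ratfun (insert a K)"] ratfun_subfield ratfun_insert[OF K p]
    unfolding L_def[symmetric] ratfun_eq_fractions[OF K, symmetric] by auto
qed

end
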